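(* For each $n\ge 2$ let $r=r_n\in[0,1/2]$ and let $\mathcal{G}_n=\{G_{ij}\}_{1\le i<j\le n}$ be a centered Gaussian field with $$\mathbb{E}(G_{ij}G_{kl})=\begin{cases}0 & \text{if } |\{i,j\}\cap\{k,l\}|=0,\\ r_n & \text{if } |\{i,j\}\cap\{k,l\}|=1,\\ 1 & \text{if } |\{i,j\}\cap\{k,l\}|=2.\end{cases}$$ Suppose that $(1-2r_n)\frac{\sqrt{\log n}}{\log\log n}\to\infty$ as $n\to\infty$. Then, with $c_n:=\sqrt{2\log n}$, $$\sqrt{2}\,c_n\left(\max_{1\le i<j\le n}G_{ij}-\sqrt{2}\,c_n+\frac{\log(4\sqrt{\pi}\,c_n)}{\sqrt{2}\,c_n}\right)$$ converges in distribution, as $n\to\infty$, to the standard Gumbel law with CDF $x\mapsto\exp(-e^{-x})$. *)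

theory Defs
  imports "HOL-Probability.Probability"
begin

definition centered_gaussian_rv :: "'a measure \<Rightarrow> ('a \<Rightarrow> real) \<Rightarrow> real \<Rightarrow> bool" where
  "centered_gaussian_rv M X v \<longleftrightarrow>
     X \<in> borel_measurable M \<and>
     (if v = 0 then (AE \<omega> in M. X \<omega> = 0)
      else distributed M lborel X (normal_density 0 (sqrt v)))"

definition centered_gaussian_field ::
  "'a measure \<Rightarrow> 'i set \<Rightarrow> ('i \<Rightarrow> 'a \<Rightarrow> real) \<Rightarrow> ('i \<Rightarrow> 'i \<Rightarrow> real) \<Rightarrow> bool" where
  "centered_gaussian_field M I G K \<longleftrightarrow>
     (\<forall>c :: 'i \<Rightarrow> real. centered_gaussian_rv M (\<lambda>\<omega>. \<Sum>p\<in>I. c p * G p \<omega>)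
        (\<Sum>p\<in>I. \<Sum>q\<in>I. c p * c q * K p q))"

definition pairs :: "nat \<Rightarrow> (nat \<times> nat) set" where
  "pairs n = {(i, j). 1 \<le> i \<and> i < j \<and> j \<le> n}"

definition edge_cov :: "real \<Rightarrow> nat \<times> nat \<Rightarrow> nat \<times> nat \<Rightarrow> real" where
  "edge_cov r p q =
     (let m = card ({fst p, snd p} \<inter> {fst q, snd q})
      in if m = 0 then 0 else if m = 1 then r else 1)"

text \<open>Standard Gumbel law, CDF x \<mapsto> exp(-exp(-x)).\<close>
definition gumbel_measure :: "real measure" where
  "gumbel_measure = density lborel (\<lambda>x. ennreal (exp (- x - exp (- x))))"

end

theory Submission
  imports Defs "HOL-Real_Asymp.Real_Asymp"
begin

text \<open>
  The law of the field is that of \<open>sqrt r * (x i + x j) + sqrt (1 - 2 * r) * z (i, j)\<close> with independent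
  standard normal vertex and edge variables. Conditionally on the vertex variables the edges are
  independent, so the distribution function of the maximum at level \<open>u\<close> is the mean of
  \<open>\<Prod>(1 - H (x i + x j))\<close>, where \<open>H\<close> is the conditional probability that an edge exceeds \<open>u\<close>.
  The product is close to \<open>exp (- S)\<close> with \<open>S = (\<Sum>H (x i + x j))\<close>, and it remains to prove a law of
  large numbers for \<open>S\<close>. For \<open>r\<close> near 1/2 the variance of \<open>S\<close> blows up because of rare
  large vertex variables. These are cut off at \<open>c = sqrt (2 * ln n)\<close>, a level that
  no vertex exceeds with high probability. All error terms are then bounded by exponential moments, and
  the growth condition makes \<open>(1 - sqrt (2 * r)) * c\<close> large compared to \<open>ln (ln n)\<close>, which beats the
  polylogarithmic factors.
\<close>

section \<open>Uniqueness of joint distribution functions\<close>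

text \<open>Why a cutoff is needed: \<open>u\<close> is about \<open>2 * sqrt (ln n)\<close>, so two
  edges with a common vertex both exceed it with probability about
  \<open>exp (- u\<^sup>2 / (1 + r))\<close>, that is, \<open>n\<close> to the power
  \<open>- 4 / (1 + r)\<close>. There are of order \<open>n ^ 3\<close> such pairs, so the
  untruncated second moment bound fails for \<open>r\<close> above 1/3. With the common vertex held
  below \<open>c\<close>, and \<open>r\<close> not small, the best exponential bound is
  \<open>n\<close> to the power -3 times \<open>exp (- T\<^sup>2 / (1 - r))\<close>, up to lower
  order corrections, where \<open>T = (1 - sqrt (2 * r)) * c\<close>. The powers of \<open>n\<close>
  then cancel exactly, and \<open>T\<close> is the only source of decay. The same \<open>T\<close>
  governs the other two errors: \<open>c - sqrt r * u\<close> is nearly \<open>T\<close> and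
  controls the mean lost by the cutoff, while \<open>u - 2 * sqrt r * c\<close> is nearly
  \<open>sqrt 2 * T\<close> and controls the largest truncated conditional probability. Replacing
  \<open>sqrt 2 * c\<close> by the true level \<open>u\<close> costs at most a fixed power of
  \<open>ln n\<close>, so a lower bound on \<open>T\<close> by a multiple of
  \<open>ln (ln n)\<close> suffices.\<close>

lemma weighted_iexp_uniqueness:
  fixes X :: "'a \<Rightarrow> real" and Y :: "'b \<Rightarrow> real" and w :: "'a \<Rightarrow> real" and v :: "'b \<Rightarrow> real"
  assumes "prob_space M" "prob_space N"
    and [measurable]: "X \<in> borel_measurable M" "Y \<in> borel_measurable N"
      "w \<in> borel_measurable M" "v \<in> borel_measurable N"
    and w: "\<And>\<omega>. 0 \<le> w \<omega>" "\<And>\<omega>. w \<omega> \<le> B" and v: "\<And>\<omega>. 0 \<le> v \<omega>" "\<And>\<omega>. v \<omega> \<le> B"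
    and eq: "\<And>s. (CLINT \<omega>|M. of_real (w \<omega>) * iexp (s * X \<omega>)) = (CLINT \<omega>|N. of_real (v \<omega>) * iexp (s * Y \<omega>))"
  shows "(LINT \<omega>|M. w \<omega> * indicator {..a} (X \<omega>)) = (LINT \<omega>|N. v \<omega> * indicator {..a} (Y \<omega>))"
proof -
  interpret M: prob_space M by fact
  interpret N: prob_space N by fact
  have intw: "integrable M w" using w by (intro M.integrable_const_bound[where B=B]) auto
  have intv: "integrable N v" using v by (intro N.integrable_const_bound[where B=B]) auto
  define m where "m = integral\<^sup>L M w"
  \<comment> \<open>At frequency 0 the hypothesis says that the two weights have the same total mass
    \<open>m\<close>. If \<open>m = 0\<close> both sides vanish; otherwise dividing by
    \<open>m\<close> gives probability densities, and Levy's uniqueness theorem applies to the laws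
    of \<open>X\<close> and \<open>Y\<close> under them.\<close>
  have "complex_of_real m = complex_of_real (integral\<^sup>L N v)"
    using eq[of 0] by (simp add: m_def)
  hence m': "integral\<^sup>L N v = m" by simp
  have "m \<ge> 0" unfolding m_def using w by simp
  show ?thesis
  proof (cases "m = 0")
    case True
    have "AE \<omega> in M. w \<omega> = 0" using True intw w unfolding m_def
      by (simp add: integral_nonneg_eq_0_iff_AE)
    hence "(LINT \<omega>|M. w \<omega> * indicator {..a} (X \<omega>)) = 0"
      by (intro integral_eq_zero_AE) auto
    moreover have "AE \<omega> in N. v \<omega> = 0" using m' True intv v
      by (simp add: integral_nonneg_eq_0_iff_AE)
    hence "(LINT \<omega>|N. v \<omega> * indicator {..a} (Y \<omega>)) = 0"
      by (intro integral_eq_zero_AE) auto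
    ultimately show ?thesis by simp
  next
    case False
    hence mpos: "m > 0" using \<open>m \<ge> 0\<close> by simp
    \<comment> \<open>Stated for an arbitrary measure \<open>K\<close>, so that it serves both
      \<open>M\<close> and \<open>N\<close>, whose sample spaces have different types.\<close>
    have *: "real_distribution (distr (density K (\<lambda>\<omega>. ennreal (g \<omega> / m))) borel Z) \<and>
        (\<forall>s. char (distr (density K (\<lambda>\<omega>. ennreal (g \<omega> / m))) borel Z) s
              = (CLINT \<omega>|K. of_real (g \<omega>) * iexp (s * Z \<omega>)) / m) \<and>
        measure (distr (density K (\<lambda>\<omega>. ennreal (g \<omega> / m))) borel Z) {..a}
              = (LINT \<omega>|K. g \<omega> * indicator {..a} (Z \<omega>)) / m"
      if [measurable]: "g \<in> borel_measurable K" "Z \<in> borel_measurable K"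
        and g: "\<And>\<omega>. 0 \<le> g \<omega>" "integrable K g" "integral\<^sup>L K g = m"
      for K :: "'c measure" and g :: "'c \<Rightarrow> real" and Z
    proof (intro conjI allI)
      let ?D = "density K (\<lambda>\<omega>. ennreal (g \<omega> / m))"
      have "emeasure ?D (space ?D) = (\<integral>\<^sup>+\<omega>. ennreal (g \<omega> / m) \<partial>K)"
        by (auto simp: emeasure_density intro!: nn_integral_cong)
      also have "\<dots> = ennreal (LINT \<omega>|K. g \<omega> / m)"
        using g mpos by (intro nn_integral_eq_integral) auto
      also have "(LINT \<omega>|K. g \<omega> / m) = 1" using g mpos by simp
      finally interpret D: prob_space ?D by (intro prob_spaceI) simp
      interpret D': prob_space "distr ?D borel Z" by (intro D.prob_space_distr) simp
      show "real_distribution (distr ?D borel Z)" by standard auto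
      show "char (distr ?D borel Z) s = (CLINT \<omega>|K. of_real (g \<omega>) * iexp (s * Z \<omega>)) / m" for s
      proof -
        have "char (distr ?D borel Z) s = (CLINT \<omega>|?D. iexp (s * Z \<omega>))"
          unfolding char_def by (intro integral_distr) auto
        also have "\<dots> = (CLINT \<omega>|K. (g \<omega> / m) *\<^sub>R iexp (s * Z \<omega>))"
          using g mpos by (intro integral_density) auto
        also have "\<dots> = (CLINT \<omega>|K. (of_real (g \<omega>) * iexp (s * Z \<omega>)) / m)"
          by (intro Bochner_Integration.integral_cong) (auto simp: scaleR_conv_of_real)
        also have "\<dots> = (CLINT \<omega>|K. of_real (g \<omega>) * iexp (s * Z \<omega>)) / m"
          by simp
        finally show ?thesis .
      qed
      have "measure (distr ?D borel Z) {..a} = (LINT y|distr ?D borel Z. indicator {..a} y)"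
        by simp
      also have "\<dots> = (LINT \<omega>|?D. indicator {..a} (Z \<omega>))"
        by (intro integral_distr) auto
      also have "\<dots> = (LINT \<omega>|K. (g \<omega> / m) *\<^sub>R indicator {..a} (Z \<omega>))"
        using g mpos by (intro integral_density) auto
      also have "\<dots> = (LINT \<omega>|K. g \<omega> * indicator {..a} (Z \<omega>)) / m"
        by (simp flip: integral_divide_zero)
      finally show "measure (distr ?D borel Z) {..a} = (LINT \<omega>|K. g \<omega> * indicator {..a} (Z \<omega>)) / m" .
    qed
    note 1 = *[of w M X] and 2 = *[of v N Y]
    have "distr (density M (\<lambda>\<omega>. ennreal (w \<omega> / m))) borel X = distr (density N (\<lambda>\<omega>. ennreal (v \<omega> / m))) borel Y"
      using 1 2 intw intv w v m' eq by (intro Levy_uniqueness) (auto simp: m_def fun_eq_iff)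
    thus ?thesis using 1 2 intw intv w v m' mpos by (auto simp: m_def)
  qed
qed

text \<open>The characteristic functional is inverted one coordinate at a time. Multiplying by
  \<^term>\<open>1 + cos R\<close> and \<^term>\<open>1 + sin R\<close> instead of \<^term>\<open>exp (\<i> * R)\<close> keeps all weights
  nonnegative, so that the uniqueness theorem for probability measures on the line applies.\<close>

lemma weighted_joint_cdf_uniqueness:
  fixes X :: "'i \<Rightarrow> 'a \<Rightarrow> real" and Y :: "'i \<Rightarrow> 'b \<Rightarrow> real"
  assumes "prob_space M" "prob_space N" "finite I"
    and "\<And>i. i \<in> I \<Longrightarrow> X i \<in> borel_measurable M" "\<And>i. i \<in> I \<Longrightarrow> Y i \<in> borel_measurable N"
      "w \<in> borel_measurable M" "v \<in> borel_measurable N"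
    and "\<And>\<omega>. 0 \<le> w \<omega>" "\<And>\<omega>. w \<omega> \<le> B" and "\<And>\<omega>. 0 \<le> v \<omega>" "\<And>\<omega>. v \<omega> \<le> B"
    and "\<And>c. (CLINT \<omega>|M. of_real (w \<omega>) * iexp (\<Sum>i\<in>I. c i * X i \<omega>)) =
              (CLINT \<omega>|N. of_real (v \<omega>) * iexp (\<Sum>i\<in>I. c i * Y i \<omega>))"
  shows "(LINT \<omega>|M. w \<omega> * (\<Prod>i\<in>I. indicator {..a i} (X i \<omega>))) =
         (LINT \<omega>|N. v \<omega> * (\<Prod>i\<in>I. indicator {..a i} (Y i \<omega>)))"
  using assms(3-)
proof (induction I arbitrary: w v rule: finite_induct)
  case empty
  from empty(9)[of "\<lambda>_. 0"] have "complex_of_real (integral\<^sup>L M w) = of_real (integral\<^sup>L N v)"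
    by simp
  thus ?case by simp
next
  case (insert j I)
  interpret M: prob_space M by fact
  interpret N: prob_space N by fact
  have [measurable]: "X j \<in> borel_measurable M" "Y j \<in> borel_measurable N"
    "w \<in> borel_measurable M" "v \<in> borel_measurable N"
    using insert.prems by auto
  have [measurable]: "(\<lambda>\<omega>. \<Sum>i\<in>I. c i * X i \<omega>) \<in> borel_measurable M"
      "(\<lambda>\<omega>. \<Sum>i\<in>I. c i * Y i \<omega>) \<in> borel_measurable N" for c
    using insert.prems by (auto intro!: borel_measurable_sum)
  have w: "0 \<le> w \<omega>" "w \<omega> \<le> B" and v: "0 \<le> v \<omega>'" "v \<omega>' \<le> B" for \<omega> \<omega>' using insert.prems by auto
  have B: "B \<ge> 0" using w[of undefined] by linarith
  \<comment> \<open>The indicator of coordinate \<open>j\<close> is absorbed into the weight. To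
    apply the induction hypothesis to these weights it remains to show that their characteristic
    functionals over \<open>I\<close> agree.\<close>
  let ?w = "\<lambda>\<omega>. w \<omega> * indicator {..a j} (X j \<omega>)" and ?v = "\<lambda>\<omega>. v \<omega> * indicator {..a j} (Y j \<omega>)"
  have "(CLINT \<omega>|M. of_real (?w \<omega>) * iexp (\<Sum>i\<in>I. c i * X i \<omega>)) =
        (CLINT \<omega>|N. of_real (?v \<omega>) * iexp (\<Sum>i\<in>I. c i * Y i \<omega>))" for c
  proof -
    let ?R = "\<lambda>\<omega>. \<Sum>i\<in>I. c i * X i \<omega>" and ?Q = "\<lambda>\<omega>. \<Sum>i\<in>I. c i * Y i \<omega>"
    have eq: "(CLINT \<omega>|M. of_real (w \<omega>) * iexp (s * X j \<omega> + k * ?R \<omega>)) =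
              (CLINT \<omega>|N. of_real (v \<omega>) * iexp (s * Y j \<omega> + k * ?Q \<omega>))" for s k
    proof -
      have "(\<Sum>i\<in>insert j I. (if i = j then s else k * c i) * Z i) = s * Z j + k * (\<Sum>i\<in>I. c i * Z i)" for Z
      proof -
        have "(\<Sum>i\<in>I. (if i = j then s else k * c i) * Z i) = (\<Sum>i\<in>I. k * (c i * Z i))"
          using insert.hyps by (intro sum.cong) auto
        thus ?thesis using insert.hyps by (simp add: sum_distrib_left)
      qed
      thus ?thesis using insert.prems(9)[of "\<lambda>i. if i = j then s else k * c i"] by simp
    qed
    \<comment> \<open>A factor \<open>T\<close> that is a combination of 1, \<open>iexp R\<close>
      and \<open>iexp (- R)\<close> only shifts the frequency in direction \<open>R\<close> by 0, 1
      or -1. Each of the three resulting integrals is covered by \<open>eq\<close>.\<close>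
    have rep: "complex_of_real (x * T) * iexp y = \<alpha> * (of_real x * iexp (y + 0 * R)) +
          \<beta> * (of_real x * iexp (y + 1 * R)) + \<gamma> * (of_real x * iexp (y + (-1) * R))"
      if "complex_of_real T = \<alpha> + \<beta> * iexp R + \<gamma> * iexp (- R)" for x y R T \<alpha> \<beta> \<gamma>
    proof -
      have "iexp (y + 0 * R) = iexp y" "iexp (y + 1 * R) = iexp y * iexp R"
        "iexp (y + (-1) * R) = iexp y * iexp (- R)"
        by (simp_all add: exp_add[symmetric] ring_distribs)
      thus ?thesis by (simp only: of_real_mult that) (simp add: algebra_simps)
    qed
    \<comment> \<open>Here \<open>w * T\<close> is a nonnegative weight bounded by
      \<open>B * 2\<close>, so the one-dimensional lemma can invert the frequency \<open>s\<close>
      of coordinate \<open>j\<close>. The choices 1, \<open>1 + cos\<close> and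
      \<open>1 + sin\<close> for \<open>T\<close> follow.\<close>
    have gen: "(LINT \<omega>|M. w \<omega> * T (?R \<omega>) * indicator {..a j} (X j \<omega>)) =
        (LINT \<omega>|N. v \<omega> * T (?Q \<omega>) * indicator {..a j} (Y j \<omega>))"
      if [measurable]: "T \<in> borel_measurable borel" and T: "\<And>z. 0 \<le> T z" "\<And>z. T z \<le> 2"
        "\<And>z. complex_of_real (T z) = \<alpha> + \<beta> * iexp z + \<gamma> * iexp (- z)" for T \<alpha> \<beta> \<gamma>
    proof (rule weighted_iexp_uniqueness[where B="B * 2", OF M.prob_space_axioms N.prob_space_axioms])
      fix s
      have iM: "integrable M (\<lambda>\<omega>. of_real (w \<omega>) * iexp (f \<omega>))"
        if [measurable]: "f \<in> borel_measurable M" for f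
        using w by (intro M.integrable_const_bound[where B=B]) (auto simp: norm_mult)
      have iN: "integrable N (\<lambda>\<omega>. of_real (v \<omega>) * iexp (f \<omega>))"
        if [measurable]: "f \<in> borel_measurable N" for f
        using v by (intro N.integrable_const_bound[where B=B]) (auto simp: norm_mult)
      have lin3: "(CLINT \<omega>|K. \<alpha> * f \<omega> + \<beta> * g \<omega> + \<gamma> * h \<omega>) =
          \<alpha> * integral\<^sup>L K f + \<beta> * integral\<^sup>L K g + \<gamma> * integral\<^sup>L K h"
        if "integrable K f" "integrable K g" "integrable K h" for K :: "'c measure" and f g h
        using that by simp
      have 1: "(CLINT \<omega>|M. of_real (w \<omega> * T (?R \<omega>)) * iexp (s * X j \<omega>)) =
          \<alpha> * (CLINT \<omega>|M. of_real (w \<omega>) * iexp (s * X j \<omega> + 0 * ?R \<omega>)) +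
          \<beta> * (CLINT \<omega>|M. of_real (w \<omega>) * iexp (s * X j \<omega> + 1 * ?R \<omega>)) +
          \<gamma> * (CLINT \<omega>|M. of_real (w \<omega>) * iexp (s * X j \<omega> + (-1) * ?R \<omega>))"
        unfolding rep[OF T(3)]
        by (intro lin3 iM) measurable
      have 2: "(CLINT \<omega>|N. of_real (v \<omega> * T (?Q \<omega>)) * iexp (s * Y j \<omega>)) =
          \<alpha> * (CLINT \<omega>|N. of_real (v \<omega>) * iexp (s * Y j \<omega> + 0 * ?Q \<omega>)) +
          \<beta> * (CLINT \<omega>|N. of_real (v \<omega>) * iexp (s * Y j \<omega> + 1 * ?Q \<omega>)) +
          \<gamma> * (CLINT \<omega>|N. of_real (v \<omega>) * iexp (s * Y j \<omega> + (-1) * ?Q \<omega>))"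
        unfolding rep[OF T(3)]
        by (intro lin3 iN) measurable
      show "(CLINT \<omega>|M. of_real (w \<omega> * T (?R \<omega>)) * iexp (s * X j \<omega>)) =
            (CLINT \<omega>|N. of_real (v \<omega> * T (?Q \<omega>)) * iexp (s * Y j \<omega>))"
        unfolding 1 2 eq ..
    qed (auto intro!: mult_mono simp: w v T B)
    have g0: "(LINT \<omega>|M. ?w \<omega>) = (LINT \<omega>|N. ?v \<omega>)"
      using gen[of "\<lambda>_. 1" 1 0 0] by simp
    have gc: "(LINT \<omega>|M. ?w \<omega> + ?w \<omega> * cos (?R \<omega>)) = (LINT \<omega>|N. ?v \<omega> + ?v \<omega> * cos (?Q \<omega>))"
    proof -
      have 1: "complex_of_real (1 + cos z) = 1 + 1/2 * iexp z + 1/2 * iexp (- z)" for z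
        by (simp add: complex_eq_iff Re_exp Im_exp)
      have 2: "0 \<le> 1 + cos z" "1 + cos z \<le> 2" for z :: real
        using cos_ge_minus_one[of z] cos_le_one[of z] by linarith+
      show ?thesis using gen[OF _ 2 1] by (simp add: algebra_simps)
    qed
    have gs: "(LINT \<omega>|M. ?w \<omega> + ?w \<omega> * sin (?R \<omega>)) = (LINT \<omega>|N. ?v \<omega> + ?v \<omega> * sin (?Q \<omega>))"
    proof -
      have 1: "complex_of_real (1 + sin z) = 1 + (-\<i>/2) * iexp z + \<i>/2 * iexp (- z)" for z
        by (simp add: complex_eq_iff Re_exp Im_exp)
      have 2: "0 \<le> 1 + sin z" "1 + sin z \<le> 2" for z :: real
        using sin_ge_minus_one[of z] sin_le_one[of z] by linarith+
      show ?thesis using gen[OF _ 2 1] by (simp add: algebra_simps)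
    qed
    have iM: "integrable M (\<lambda>\<omega>. ?w \<omega> * f \<omega>)"
      if [measurable]: "f \<in> borel_measurable M" and "\<And>\<omega>. \<bar>f \<omega>\<bar> \<le> 1" for f
    proof (rule M.integrable_const_bound[where B=B])
      show "AE \<omega> in M. norm (?w \<omega> * f \<omega>) \<le> B"
        using mult_mono[OF w(2) that(2), simplified mult_1_right] w B
        by (auto simp: abs_mult indicator_def intro!: AE_I2)
    qed auto
    have iN: "integrable N (\<lambda>\<omega>. ?v \<omega> * f \<omega>)"
      if [measurable]: "f \<in> borel_measurable N" and "\<And>\<omega>. \<bar>f \<omega>\<bar> \<le> 1" for f
    proof (rule N.integrable_const_bound[where B=B])
      show "AE \<omega> in N. norm (?v \<omega> * f \<omega>) \<le> B"
        using mult_mono[OF v(2) that(2), simplified mult_1_right] v B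
        by (auto simp: abs_mult indicator_def intro!: AE_I2)
    qed auto
    have iM1: "integrable M ?w" using iM[of "\<lambda>_. 1"] by simp
    have iN1: "integrable N ?v" using iN[of "\<lambda>_. 1"] by simp
    have ci: "complex_of_real x * iexp y = of_real (x * cos y) + \<i> * of_real (x * sin y)" for x y
      by (simp add: exp_eq_polar cis_conv_exp[symmetric] complex_eq_iff)
    have eM: "(CLINT \<omega>|M. of_real (?w \<omega>) * iexp (?R \<omega>)) =
        of_real (LINT \<omega>|M. ?w \<omega> * cos (?R \<omega>)) + \<i> * of_real (LINT \<omega>|M. ?w \<omega> * sin (?R \<omega>))"
      unfolding ci by (subst Bochner_Integration.integral_add)
        (auto intro!: integrable_mult_right integrable_of_real iM simp del: of_real_mult)
    have eN: "(CLINT \<omega>|N. of_real (?v \<omega>) * iexp (?Q \<omega>)) =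
        of_real (LINT \<omega>|N. ?v \<omega> * cos (?Q \<omega>)) + \<i> * of_real (LINT \<omega>|N. ?v \<omega> * sin (?Q \<omega>))"
      unfolding ci by (subst Bochner_Integration.integral_add)
        (auto intro!: integrable_mult_right integrable_of_real iN simp del: of_real_mult)
    \<comment> \<open>Subtracting the case \<open>T = 1\<close> removes the constants that were
      added for positivity and leaves the real and imaginary parts.\<close>
    have "(LINT \<omega>|M. ?w \<omega> * cos (?R \<omega>)) = (LINT \<omega>|N. ?v \<omega> * cos (?Q \<omega>))"
      using gc g0 by (simp add: iM iN iM1 iN1)
    moreover have "(LINT \<omega>|M. ?w \<omega> * sin (?R \<omega>)) = (LINT \<omega>|N. ?v \<omega> * sin (?Q \<omega>))"
      using gs g0 by (simp add: iM iN iM1 iN1)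
    ultimately show ?thesis unfolding eM eN by simp
  qed
  moreover have "?w \<omega> \<le> B" "?v \<omega>' \<le> B" for \<omega> \<omega>' using w v B by (auto simp: indicator_def)
  ultimately have "(LINT \<omega>|M. ?w \<omega> * (\<Prod>i\<in>I. indicator {..a i} (X i \<omega>))) =
        (LINT \<omega>|N. ?v \<omega> * (\<Prod>i\<in>I. indicator {..a i} (Y i \<omega>)))"
    using insert.prems(1,2) w v by (intro insert.IH) simp_all
  thus ?case using insert.hyps by (simp add: mult_ac)
qed

text \<open>The case of weight 1. It needs no joint density, so it also covers degenerate Gaussian
  vectors, and the two families may live on different probability spaces.\<close>

lemma joint_cdf_uniqueness:
  fixes X :: "'i \<Rightarrow> 'a \<Rightarrow> real" and Y :: "'i \<Rightarrow> 'b \<Rightarrow> real"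
  assumes "prob_space M" "prob_space N" "finite I"
    and X: "\<And>i. i \<in> I \<Longrightarrow> X i \<in> borel_measurable M" and Y: "\<And>i. i \<in> I \<Longrightarrow> Y i \<in> borel_measurable N"
    and eq: "\<And>c. (CLINT \<omega>|M. iexp (\<Sum>i\<in>I. c i * X i \<omega>)) = (CLINT \<omega>|N. iexp (\<Sum>i\<in>I. c i * Y i \<omega>))"
  shows "measure M {\<omega>\<in>space M. \<forall>i\<in>I. X i \<omega> \<le> a i} = measure N {\<omega>\<in>space N. \<forall>i\<in>I. Y i \<omega> \<le> a i}"
proof -
  have *: "measure K {\<omega>\<in>space K. \<forall>i\<in>I. Z i \<omega> \<le> a i} = (LINT \<omega>|K. (\<Prod>i\<in>I. indicator {..a i} (Z i \<omega>)))"
    for K :: "'c measure" and Z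
  proof -
    have "(LINT \<omega>|K. (\<Prod>i\<in>I. indicator {..a i} (Z i \<omega>))) =
        (LINT \<omega>|K. indicat_real {\<omega>\<in>space K. \<forall>i\<in>I. Z i \<omega> \<le> a i} \<omega>)"
    proof (intro Bochner_Integration.integral_cong refl)
      fix \<omega> assume \<omega>: "\<omega> \<in> space K"
      show "(\<Prod>i\<in>I. indicator {..a i} (Z i \<omega>)) = indicat_real {\<omega>\<in>space K. \<forall>i\<in>I. Z i \<omega> \<le> a i} \<omega>"
      proof (cases "\<forall>i\<in>I. Z i \<omega> \<le> a i")
        case True
        thus ?thesis using \<omega> by simp
      next
        case False
        then obtain i where "i \<in> I" "\<not> Z i \<omega> \<le> a i" by blast
        hence "(\<Prod>i\<in>I. indicat_real {..a i} (Z i \<omega>)) = 0"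
          using \<open>finite I\<close> by (intro prod_zero bexI[of _ i]) simp_all
        thus ?thesis using False by simp
      qed
    qed
    also have "\<dots> = measure K ({\<omega>\<in>space K. \<forall>i\<in>I. Z i \<omega> \<le> a i} \<inter> space K)"
      by (rule Bochner_Integration.integral_indicator)
    also have "{\<omega>\<in>space K. \<forall>i\<in>I. Z i \<omega> \<le> a i} \<inter> space K = {\<omega>\<in>space K. \<forall>i\<in>I. Z i \<omega> \<le> a i}"
      by blast
    finally show ?thesis ..
  qed
  have "(LINT \<omega>|M. 1 * (\<Prod>i\<in>I. indicat_real {..a i} (X i \<omega>))) =
        (LINT \<omega>|N. 1 * (\<Prod>i\<in>I. indicator {..a i} (Y i \<omega>)))"
  proof (rule weighted_joint_cdf_uniqueness[OF assms(1-3) X Y, where B=1 and w="\<lambda>_. 1" and v="\<lambda>_. 1"])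
    show "(CLINT \<omega>|M. of_real 1 * iexp (\<Sum>i\<in>I. c i * X i \<omega>)) =
          (CLINT \<omega>|N. of_real 1 * iexp (\<Sum>i\<in>I. c i * Y i \<omega>))" for c
      using eq[of c] by (simp only: of_real_1 mult_1_left)
  qed simp_all
  thus ?thesis unfolding *[of M X] *[of N Y] by (simp only: mult_1_left)
qed

section \<open>The Gaussian field and its vertex-edge representation\<close>

lemma iexp_centered_gaussian_rv:
  assumes "prob_space M" "centered_gaussian_rv M X v" "v \<ge> 0"
  shows "(CLINT \<omega>|M. iexp (X \<omega>)) = of_real (exp (- v / 2))"
proof (cases "v = 0")
  case True
  interpret prob_space M by fact
  have "AE \<omega> in M. X \<omega> = 0" and [measurable]: "X \<in> borel_measurable M"
    using assms True by (auto simp: centered_gaussian_rv_def)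
  hence "(CLINT \<omega>|M. iexp (X \<omega>)) = (CLINT \<omega>|M. 1)"
    by (intro integral_cong_AE) auto
  thus ?thesis using True by (simp add: prob_space)
next
  case False
  interpret prob_space M by fact
  have [measurable]: "X \<in> borel_measurable M" and "distributed M lborel X (normal_density 0 (sqrt v))"
    using assms False by (auto simp: centered_gaussian_rv_def)
  hence "distributed M lborel (\<lambda>\<omega>. X \<omega> / sqrt v) std_normal_density"
    using normal_standard_normal_convert[of "sqrt v" X 0] False assms by simp
  hence "distr M lborel (\<lambda>\<omega>. X \<omega> / sqrt v) = std_normal_distribution"
    by (simp add: distributed_def)
  hence "of_real (exp (- (sqrt v)\<^sup>2 / 2)) = (CLINT y|distr M lborel (\<lambda>\<omega>. X \<omega> / sqrt v). iexp (sqrt v * y))"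
    using char_std_normal_distribution by (simp add: char_def fun_eq_iff)
  also have "\<dots> = (CLINT \<omega>|M. iexp (sqrt v * (X \<omega> / sqrt v)))"
    by (intro integral_distr) auto
  finally show ?thesis using False assms by simp
qed

lemma centered_gaussian_field_subset:
  fixes G :: "'i \<Rightarrow> 'a \<Rightarrow> real"
  assumes "centered_gaussian_field M I G K" "J \<subseteq> I" "finite I"
  shows "centered_gaussian_field M J G K"
  unfolding centered_gaussian_field_def
proof
  fix c :: "'i \<Rightarrow> real"
  let ?c = "\<lambda>p. if p \<in> J then c p else 0"
  have *: "(\<Sum>p\<in>I. ?c p * f p) = (\<Sum>p\<in>J. c p * f p)" for f :: "'i \<Rightarrow> real"
    using assms(2,3) by (intro sum.mono_neutral_cong_right) auto
  have "(\<Sum>p\<in>I. \<Sum>q\<in>I. ?c p * ?c q * K p q) = (\<Sum>p\<in>I. ?c p * (\<Sum>q\<in>I. ?c q * K p q))"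
    by (simp add: sum_distrib_left mult.assoc)
  also have "\<dots> = (\<Sum>p\<in>J. \<Sum>q\<in>J. c p * c q * K p q)"
    unfolding * by (simp add: sum_distrib_left mult.assoc)
  finally have "(\<Sum>p\<in>I. \<Sum>q\<in>I. ?c p * ?c q * K p q) = (\<Sum>p\<in>J. \<Sum>q\<in>J. c p * c q * K p q)" .
  with assms(1)[unfolded centered_gaussian_field_def, rule_format, of ?c]
  show "centered_gaussian_rv M (\<lambda>\<omega>. \<Sum>p\<in>J. c p * G p \<omega>) (\<Sum>p\<in>J. \<Sum>q\<in>J. c p * c q * K p q)"
    by (simp only: *)
qed

lemma centered_gaussian_field_measurable:
  assumes "centered_gaussian_field M I G K" "p \<in> I" "finite I"
  shows "G p \<in> borel_measurable M"
proof -
  have "centered_gaussian_field M {p} G K"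
    using assms by (intro centered_gaussian_field_subset[OF assms(1)]) auto
  from this[unfolded centered_gaussian_field_def, rule_format, of "\<lambda>_. 1"]
  show ?thesis by (simp add: centered_gaussian_rv_def)
qed

lemma finite_pairs: "finite (pairs n)"
  by (rule finite_subset[of _ "{1..n} \<times> {1..n}"]) (auto simp: pairs_def)

text \<open>Counting coincidences of endpoints makes the covariance bilinear. Since
  \<open>fst p < snd p\<close>, one common vertex gives exactly one coincidence, while
  \<open>p = q\<close> gives two, and \<open>2 * r + (1 - 2 * r) = 1\<close>.\<close>

lemma edge_cov_eq:
  assumes "p \<in> pairs n" "q \<in> pairs n"
  shows "edge_cov r p q = r * (of_bool (fst p = fst q) + of_bool (fst p = snd q) +
           of_bool (snd p = fst q) + of_bool (snd p = snd q)) + (1 - 2 * r) * of_bool (p = q)"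
  using assms by (cases p; cases q) (auto simp: pairs_def edge_cov_def Int_insert_left Let_def)

text \<open>The inner sum over \<open>p\<close> is the coefficient that vertex \<open>i\<close>
  receives in the linear combination. The two summands are thus the variances of the vertex part and
  of the edge part, and for \<open>r\<close> in [0, 1/2] they show that the form is
  nonnegative.\<close>

lemma edge_cov_quadratic_form:
  assumes E: "E \<subseteq> pairs n"
  shows "(\<Sum>p\<in>E. \<Sum>q\<in>E. c p * c q * edge_cov r p q) =
    r * (\<Sum>i\<in>{1..n}. (\<Sum>p\<in>E. c p * (of_bool (fst p = i) + of_bool (snd p = i)))\<^sup>2)
      + (1 - 2 * r) * (\<Sum>p\<in>E. (c p)\<^sup>2)"
proof -
  define b :: "nat \<Rightarrow> nat \<times> nat \<Rightarrow> real" where "b i p = of_bool (fst p = i) + of_bool (snd p = i)" for i p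
  have fin: "finite E" using E finite_pairs finite_subset by blast
  have bb: "(\<Sum>i\<in>{1..n}. b i p * b i q) = of_bool (fst p = fst q) + of_bool (fst p = snd q) +
           of_bool (snd p = fst q) + of_bool (snd p = snd q)" if "p \<in> E" "q \<in> E" for p q
  proof -
    have "fst p \<in> {1..n}" "snd p \<in> {1..n}" using that E by (auto simp: pairs_def)
    moreover have "(\<Sum>i\<in>{1..n}. of_bool (k = i) * of_bool (l = i)) = (of_bool (k = l) :: real)"
      if "k \<in> {1..n}" for k l
      using that by (subst sum.remove[of _ k]) (auto intro!: sum.neutral)
    ultimately show ?thesis
      unfolding b_def ring_distribs sum.distrib by (simp del: sum_of_bool_mult_eq sum_mult_of_bool_eq)
  qed
  have "(\<Sum>i\<in>{1..n}. (\<Sum>p\<in>E. c p * b i p)\<^sup>2) =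
      (\<Sum>i\<in>{1..n}. \<Sum>p\<in>E. \<Sum>q\<in>E. c p * c q * (b i p * b i q))"
    by (simp add: power2_eq_square sum_product mult_ac)
  also have "\<dots> = (\<Sum>p\<in>E. \<Sum>q\<in>E. \<Sum>i\<in>{1..n}. c p * c q * (b i p * b i q))"
    by (subst sum.swap, rule sum.cong[OF refl], subst sum.swap) simp
  also have "\<dots> = (\<Sum>p\<in>E. \<Sum>q\<in>E. c p * c q * (\<Sum>i\<in>{1..n}. b i p * b i q))"
    by (simp add: sum_distrib_left)
  finally have 1: "r * (\<Sum>i\<in>{1..n}. (\<Sum>p\<in>E. c p * b i p)\<^sup>2) =
      (\<Sum>p\<in>E. \<Sum>q\<in>E. r * (c p * c q * (\<Sum>i\<in>{1..n}. b i p * b i q)))"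
    by (simp add: sum_distrib_left)
  have 2: "(1 - 2 * r) * (\<Sum>p\<in>E. (c p)\<^sup>2) = (\<Sum>p\<in>E. \<Sum>q\<in>E. (1 - 2 * r) * (c p * c q * of_bool (p = q)))"
    unfolding sum_distrib_left
  proof (rule sum.cong[OF refl])
    fix p assume "p \<in> E"
    thus "(1 - 2 * r) * (c p)\<^sup>2 = (\<Sum>q\<in>E. (1 - 2 * r) * (c p * c q * of_bool (p = q)))"
      using fin by (subst sum.remove[of _ p]) (auto simp: power2_eq_square intro!: sum.neutral)
  qed
  show ?thesis
    unfolding b_def[symmetric] 1 2 sum.distrib[symmetric]
  proof (intro sum.cong refl)
    fix p q assume pq: "p \<in> E" "q \<in> E"
    hence "p \<in> pairs n" "q \<in> pairs n" using E by auto
    from edge_cov_eq[OF this, of r] bb[OF pq]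
    show "c p * c q * edge_cov r p q = r * (c p * c q * (\<Sum>i = 1..n. b i p * b i q)) +
           (1 - 2 * r) * (c p * c q * of_bool (p = q))"
      by (simp only:) (simp only: ring_distribs mult_ac)
  qed
qed

section \<open>The vertex-edge model\<close>

abbreviation std_normal_product :: "'i set \<Rightarrow> ('i \<Rightarrow> real) measure" where
  "std_normal_product I \<equiv> Pi\<^sub>M I (\<lambda>_. std_normal_distribution)"

lemma prob_space_std_normal_distribution: "prob_space std_normal_distribution"
  using real_dist_normal_dist by (simp add: real_distribution_def)

lemma prob_space_std_normal_product: "prob_space (std_normal_product I)"
  by (intro prob_space_PiM prob_space_std_normal_distribution)

lemma product_sigma_finite_std_normal: "product_sigma_finite (\<lambda>_. std_normal_distribution)"
  by (simp add: product_sigma_finite_def prob_space_imp_sigma_finite prob_space_std_normal_distribution)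

lemma integral_iexp_std_normal_product:
  assumes "finite I"
  shows "(CLINT x|std_normal_product I. iexp (\<Sum>i\<in>I. a i * x i)) = of_real (exp (- (\<Sum>i\<in>I. (a i)\<^sup>2) / 2))"
proof -
  interpret S: real_distribution std_normal_distribution by (rule real_dist_normal_dist)
  interpret product_sigma_finite "\<lambda>_. std_normal_distribution" by (rule product_sigma_finite_std_normal)
  have "(CLINT x|std_normal_product I. iexp (\<Sum>i\<in>I. a i * x i)) =
        (CLINT x|std_normal_product I. (\<Prod>i\<in>I. iexp (a i * x i)))"
    using assms by (simp add: exp_sum sum_distrib_left)
  also have "\<dots> = (\<Prod>i\<in>I. (CLINT y|std_normal_distribution. iexp (a i * y)))"
    using assms by (intro product_integral_prod S.integrable_const_bound[where B=1]) auto
  also have "\<dots> = (\<Prod>i\<in>I. of_real (exp (- (a i)\<^sup>2 / 2)))"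
    using char_std_normal_distribution by (simp add: char_def fun_eq_iff)
  also have "\<dots> = of_real (exp (- (\<Sum>i\<in>I. (a i)\<^sup>2) / 2))"
    using assms by (simp add: sum_divide_distrib exp_sum[symmetric] sum_negf flip: of_real_prod)
  finally show ?thesis .
qed

text \<open>If the vertex variables \<open>x i\<close> and the edge variables \<open>z p\<close> are independent standard normal,
  then \<open>\<lambda>p. edge_value r p (x, z)\<close> is a Gaussian field with covariance \<open>edge_cov r\<close>.\<close>

definition edge_value :: "real \<Rightarrow> nat \<times> nat \<Rightarrow> (nat \<Rightarrow> real) \<times> (nat \<times> nat \<Rightarrow> real) \<Rightarrow> real" where
  "edge_value r p = (\<lambda>(x, z). sqrt r * (x (fst p) + x (snd p)) + sqrt (1 - 2 * r) * z p)"

text \<open>The function \<open>H\<close> of the overview; \<open>s\<close> is the sum of the two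
  endpoint variables. There is no division by \<open>sqrt (1 - 2 * r)\<close>, so
  \<open>r = 1/2\<close> is included: the value is then 0 or 1.\<close>

definition edge_tail :: "real \<Rightarrow> real \<Rightarrow> real \<Rightarrow> real" where
  "edge_tail r u s = measure std_normal_distribution {z. u < sqrt r * s + sqrt (1 - 2 * r) * z}"

abbreviation vertex_edge_measure :: "nat \<Rightarrow> (nat \<times> nat) set \<Rightarrow> ((nat \<Rightarrow> real) \<times> (nat \<times> nat \<Rightarrow> real)) measure" where
  "vertex_edge_measure n E \<equiv> std_normal_product {1..n} \<Otimes>\<^sub>M std_normal_product E"

lemma prob_space_vertex_edge_measure: "prob_space (vertex_edge_measure n E)"
proof -
  interpret pair_prob_space "std_normal_product {1..n}" "std_normal_product E"
    by (simp add: pair_prob_space_def pair_sigma_finite_def prob_space_std_normal_product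
          prob_space_imp_sigma_finite)
  show ?thesis by (rule P.prob_space_axioms)
qed

lemma measurable_component_std_normal:
  "i \<in> I \<Longrightarrow> (\<lambda>x. x i) \<in> borel_measurable (std_normal_product I)"
  using measurable_component_singleton[of i I "\<lambda>_. std_normal_distribution"] by simp

lemma measurable_edge_value:
  assumes "E \<subseteq> pairs n" "p \<in> E"
  shows "edge_value r p \<in> borel_measurable (vertex_edge_measure n E)"
proof -
  have p: "fst p \<in> {1..n}" "snd p \<in> {1..n}" using assms by (auto simp: pairs_def)
  show ?thesis unfolding edge_value_def case_prod_beta
    by (intro borel_measurable_add borel_measurable_times borel_measurable_const
          measurable_compose[OF measurable_fst measurable_component_std_normal[OF p(1)]]
          measurable_compose[OF measurable_fst measurable_component_std_normal[OF p(2)]]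
          measurable_compose[OF measurable_snd measurable_component_std_normal[OF assms(2)]])
qed

lemma integral_iexp_edge_value:
  assumes E: "E \<subseteq> pairs n" and r: "0 \<le> r" "r \<le> 1/2"
  shows "(CLINT \<omega>|vertex_edge_measure n E. iexp (\<Sum>p\<in>E. c p * edge_value r p \<omega>)) =
         of_real (exp (- (\<Sum>p\<in>E. \<Sum>q\<in>E. c p * c q * edge_cov r p q) / 2))"
proof -
  let ?N1 = "std_normal_product {1..n}" and ?N2 = "std_normal_product E"
  interpret pair_prob_space ?N1 ?N2
    by (simp add: pair_prob_space_def pair_sigma_finite_def prob_space_std_normal_product
          prob_space_imp_sigma_finite)
  have fin: "finite E" using E finite_pairs finite_subset by blast
  \<comment> \<open>\<open>sqrt r * d i\<close> is the total coefficient of the vertex variable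
    \<open>x i\<close>. Regrouping by vertices turns the exponent into a function of
    \<open>x\<close> plus a function of \<open>z\<close>, so the integral factorises.\<close>
  define d where "d i = (\<Sum>p\<in>E. c p * (of_bool (fst p = i) + of_bool (snd p = i)))" for i
  have dec: "(\<Sum>p\<in>E. c p * edge_value r p (x, z)) =
      (\<Sum>i\<in>{1..n}. (sqrt r * d i) * x i) + (\<Sum>p\<in>E. (sqrt (1 - 2 * r) * c p) * z p)" for x z
  proof -
    have "(\<Sum>i\<in>{1..n}. d i * x i) =
        (\<Sum>p\<in>E. \<Sum>i\<in>{1..n}. c p * (of_bool (fst p = i) + of_bool (snd p = i)) * x i)"
      unfolding d_def by (subst sum.swap) (simp add: sum_distrib_right)
    also have "\<dots> = (\<Sum>p\<in>E. c p * (x (fst p) + x (snd p)))"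
    proof (rule sum.cong[OF refl])
      fix p assume "p \<in> E"
      hence p: "fst p \<in> {1..n}" "snd p \<in> {1..n}" using E by (auto simp: pairs_def)
      have "(\<Sum>i\<in>{1..n}. of_bool (k = i) * x i) = x k" if "k \<in> {1..n}" for k
        using that by (subst sum.remove[of _ k]) (auto intro!: sum.neutral)
      note * = this[OF p(1)] this[OF p(2)]
      have "(\<Sum>i\<in>{1..n}. c p * (of_bool (fst p = i) + of_bool (snd p = i)) * x i) =
          c p * ((\<Sum>i\<in>{1..n}. of_bool (fst p = i) * x i) + (\<Sum>i\<in>{1..n}. of_bool (snd p = i) * x i))"
        by (simp add: sum_distrib_left ring_distribs sum.distrib mult.assoc del: sum_of_bool_mult_eq sum_mult_of_bool_eq)
      thus "(\<Sum>i\<in>{1..n}. c p * (of_bool (fst p = i) + of_bool (snd p = i)) * x i) = c p * (x (fst p) + x (snd p))"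
        unfolding * .
    qed
    finally have "sqrt r * (\<Sum>i\<in>{1..n}. d i * x i) = (\<Sum>p\<in>E. c p * (sqrt r * (x (fst p) + x (snd p))))"
      by (simp add: sum_distrib_left mult_ac)
    thus ?thesis
      by (simp add: edge_value_def ring_distribs sum.distrib sum_distrib_left mult_ac)
  qed
  have [measurable]: "(\<lambda>x. \<Sum>i\<in>{1..n}. a i * x i) \<in> borel_measurable ?N1" for a
    by (intro borel_measurable_sum borel_measurable_times borel_measurable_const measurable_component_std_normal)
  have [measurable]: "(\<lambda>x. \<Sum>i\<in>E. a i * x i) \<in> borel_measurable ?N2" for a
    by (intro borel_measurable_sum borel_measurable_times borel_measurable_const measurable_component_std_normal)
  let ?f = "\<lambda>x. iexp (\<Sum>i\<in>{1..n}. (sqrt r * d i) * x i)" and ?g = "\<lambda>z. iexp (\<Sum>p\<in>E. (sqrt (1 - 2 * r) * c p) * z p)"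
  have "(CLINT \<omega>|vertex_edge_measure n E. iexp (\<Sum>p\<in>E. c p * edge_value r p \<omega>)) =
        (CLINT \<omega>|vertex_edge_measure n E. ?f (fst \<omega>) * ?g (snd \<omega>))"
    by (intro Bochner_Integration.integral_cong refl)
       (simp add: dec case_prod_beta split_paired_all exp_add[symmetric] ring_distribs del: of_real_sum)
  also have "\<dots> = (CLINT x|?N1. CLINT z|?N2. ?f x * ?g z)"
  proof -
    have "complex_integrable (?N1 \<Otimes>\<^sub>M ?N2) (\<lambda>\<omega>. ?f (fst \<omega>) * ?g (snd \<omega>))"
      by (intro P.integrable_const_bound[where B=1]) (auto simp: norm_mult simp del: of_real_sum)
    from integral_fst'[OF this] show ?thesis by simp
  qed
  also have "\<dots> = (CLINT x|?N1. ?f x) * (CLINT z|?N2. ?g z)" by simp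
  also have "\<dots> = of_real (exp (- (\<Sum>i\<in>{1..n}. (sqrt r * d i)\<^sup>2) / 2)) *
      of_real (exp (- (\<Sum>p\<in>E. (sqrt (1 - 2 * r) * c p)\<^sup>2) / 2))"
    using fin by (simp only: integral_iexp_std_normal_product finite_atLeastAtMost)
  also have "(\<Sum>i\<in>{1..n}. (sqrt r * d i)\<^sup>2) = r * (\<Sum>i\<in>{1..n}. (d i)\<^sup>2)"
    using r by (simp add: power_mult_distrib sum_distrib_left)
  also have "(\<Sum>p\<in>E. (sqrt (1 - 2 * r) * c p)\<^sup>2) = (1 - 2 * r) * (\<Sum>p\<in>E. (c p)\<^sup>2)"
    using r by (simp add: power_mult_distrib sum_distrib_left)
  also have "complex_of_real (exp (- (r * (\<Sum>i\<in>{1..n}. (d i)\<^sup>2)) / 2)) *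
        complex_of_real (exp (- ((1 - 2 * r) * (\<Sum>p\<in>E. (c p)\<^sup>2)) / 2)) =
      of_real (exp (- (r * (\<Sum>i\<in>{1..n}. (d i)\<^sup>2) + (1 - 2 * r) * (\<Sum>p\<in>E. (c p)\<^sup>2)) / 2))"
    by (simp only: of_real_mult[symmetric] exp_add[symmetric]) (simp add: field_simps)
  also have "r * (\<Sum>i\<in>{1..n}. (d i)\<^sup>2) + (1 - 2 * r) * (\<Sum>p\<in>E. (c p)\<^sup>2) =
      (\<Sum>p\<in>E. \<Sum>q\<in>E. c p * c q * edge_cov r p q)"
    unfolding d_def by (rule edge_cov_quadratic_form[OF E, symmetric])
  finally show ?thesis .
qed

lemma edge_tail_bounds: "0 \<le> edge_tail r u s" "edge_tail r u s \<le> 1"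
  using prob_space.prob_le_1[OF prob_space_std_normal_distribution] by (simp_all add: edge_tail_def)

lemma edge_tail_complement:
  "measure std_normal_distribution {z. sqrt r * s + sqrt (1 - 2 * r) * z \<le> u} = 1 - edge_tail r u s"
proof -
  interpret prob_space std_normal_distribution by (rule prob_space_std_normal_distribution)
  have "{z. sqrt r * s + sqrt (1 - 2 * r) * z \<le> u} = space std_normal_distribution - {z. u < sqrt r * s + sqrt (1 - 2 * r) * z}"
    by auto
  thus ?thesis unfolding edge_tail_def by (simp only:) (subst prob_compl, auto)
qed

lemma borel_measurable_edge_tail [measurable]: "edge_tail r u \<in> borel_measurable borel"
proof -
  interpret sigma_finite_measure std_normal_distribution
    by (rule prob_space_imp_sigma_finite[OF prob_space_std_normal_distribution])
  have "(\<lambda>s. LINT z|std_normal_distribution. indicat_real {(s, z). u < sqrt r * s + sqrt (1 - 2 * r) * z} (s, z))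
      \<in> borel_measurable borel"
    by measurable
  also have "(\<lambda>s. LINT z|std_normal_distribution. indicat_real {(s, z). u < sqrt r * s + sqrt (1 - 2 * r) * z} (s, z))
      = (\<lambda>s. LINT z|std_normal_distribution. indicat_real {z. u < sqrt r * s + sqrt (1 - 2 * r) * z} z)"
    by (simp add: indicator_def)
  also have "\<dots> = edge_tail r u"
    by (auto simp: edge_tail_def fun_eq_iff)
  finally show ?thesis .
qed

lemma prob_edge_value_le:
  assumes E: "E \<subseteq> pairs n"
  shows "measure (vertex_edge_measure n E) {\<omega>\<in>space (vertex_edge_measure n E). \<forall>p\<in>E. edge_value r p \<omega> \<le> u} =
         (LINT x|std_normal_product {1..n}. (\<Prod>p\<in>E. 1 - edge_tail r u (x (fst p) + x (snd p))))"
proof -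
  let ?N1 = "std_normal_product {1..n}" and ?N2 = "std_normal_product E"
  interpret S: prob_space std_normal_distribution by (rule prob_space_std_normal_distribution)
  interpret product_sigma_finite "\<lambda>_. std_normal_distribution" by (rule product_sigma_finite_std_normal)
  interpret pair_prob_space ?N1 ?N2
    by (simp add: pair_prob_space_def pair_sigma_finite_def prob_space_std_normal_product
          prob_space_imp_sigma_finite)
  have fin: "finite E" using E finite_pairs finite_subset by blast
  let ?A = "{\<omega>\<in>space (?N1 \<Otimes>\<^sub>M ?N2). \<forall>p\<in>E. edge_value r p \<omega> \<le> u}"
  have A: "?A \<in> sets (?N1 \<Otimes>\<^sub>M ?N2)"
    by (intro sets.sets_Collect_finite_All fin borel_measurable_le borel_measurable_const measurable_edge_value[OF E])
  have "measure (?N1 \<Otimes>\<^sub>M ?N2) ?A = (LINT \<omega>|(?N1 \<Otimes>\<^sub>M ?N2). indicat_real ?A \<omega>)"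
    using sets.sets_into_space[OF A] by (simp add: Int_absorb2)
  also have "\<dots> = (LINT x|?N1. LINT z|?N2. indicat_real ?A (x, z))"
    using A by (intro integral_fst'[symmetric] P.integrable_const_bound[where B=1]) auto
  also have "\<dots> = (LINT x|?N1. (\<Prod>p\<in>E. 1 - edge_tail r u (x (fst p) + x (snd p))))"
  proof (intro Bochner_Integration.integral_cong refl)
    fix x assume x: "x \<in> space ?N1"
    let ?B = "\<lambda>p. {z. sqrt r * (x (fst p) + x (snd p)) + sqrt (1 - 2 * r) * z \<le> u}"
    have "(LINT z|?N2. indicat_real ?A (x, z)) = (LINT z|?N2. (\<Prod>p\<in>E. indicat_real (?B p) (z p)))"
    proof (intro Bochner_Integration.integral_cong refl)
      fix z assume z: "z \<in> space ?N2"
      have A_iff: "(x, z) \<in> ?A \<longleftrightarrow> (\<forall>p\<in>E. z p \<in> ?B p)"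
        using x z by (simp add: space_pair_measure edge_value_def)
      show "indicat_real ?A (x, z) = (\<Prod>p\<in>E. indicat_real (?B p) (z p))"
      proof (cases "\<forall>p\<in>E. z p \<in> ?B p")
        case True
        have "(\<Prod>p\<in>E. indicat_real (?B p) (z p)) = 1" using True by (intro prod.neutral) auto
        moreover have "(x, z) \<in> ?A" using True A_iff by blast
        ultimately show ?thesis by (metis (lifting) indicator_simps(1))
      next
        case False
        then obtain p where "p \<in> E" "z p \<notin> ?B p" by blast
        hence "(\<Prod>p\<in>E. indicat_real (?B p) (z p)) = 0"
          using fin by (intro prod_zero bexI[of _ p] indicator_simps(2))
        moreover have "(x, z) \<notin> ?A" using False A_iff by blast
        ultimately show ?thesis by (metis (lifting) indicator_simps(2))
      qed
    qed
    also have "\<dots> = (\<Prod>p\<in>E. (LINT z|std_normal_distribution. indicat_real (?B p) z))"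
      using fin by (intro product_integral_prod S.integrable_const_bound[where B=1]) auto
    also have "\<dots> = (\<Prod>p\<in>E. 1 - edge_tail r u (x (fst p) + x (snd p)))"
      by (simp add: edge_tail_complement)
    finally show "(LINT z|?N2. indicat_real ?A (x, z)) = (\<Prod>p\<in>E. 1 - edge_tail r u (x (fst p) + x (snd p)))" .
  qed
  finally show ?thesis .
qed

text \<open>Both sides have the characteristic functional \<open>exp (- q / 2)\<close> with the same
  quadratic form \<open>q\<close>, so the field can be replaced by the vertex-edge model.\<close>

lemma prob_gaussian_field_le:
  assumes "prob_space M" and field: "centered_gaussian_field M (pairs n) G (edge_cov r)"
    and r: "0 \<le> r" "r \<le> 1/2" and E: "E \<subseteq> pairs n"
  shows "measure M {\<omega>\<in>space M. \<forall>p\<in>E. G p \<omega> \<le> u} =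
         (LINT x|std_normal_product {1..n}. (\<Prod>p\<in>E. 1 - edge_tail r u (x (fst p) + x (snd p))))"
proof -
  have fin: "finite E" using E finite_pairs finite_subset by blast
  have "measure M {\<omega>\<in>space M. \<forall>p\<in>E. G p \<omega> \<le> u} =
     measure (vertex_edge_measure n E) {\<omega>\<in>space (vertex_edge_measure n E). \<forall>p\<in>E. edge_value r p \<omega> \<le> u}"
  proof (rule joint_cdf_uniqueness[OF assms(1) prob_space_vertex_edge_measure fin])
    show "G p \<in> borel_measurable M" if "p \<in> E" for p
      using centered_gaussian_field_measurable[OF field] that E finite_pairs by blast
    show "edge_value r p \<in> borel_measurable (vertex_edge_measure n E)" if "p \<in> E" for p
      by (rule measurable_edge_value[OF E that])
    show "(CLINT \<omega>|M. iexp (\<Sum>p\<in>E. c p * G p \<omega>)) =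
          (CLINT \<omega>|vertex_edge_measure n E. iexp (\<Sum>p\<in>E. c p * edge_value r p \<omega>))" for c
      unfolding integral_iexp_edge_value[OF E r]
    proof (rule iexp_centered_gaussian_rv[OF assms(1)])
      show "centered_gaussian_rv M (\<lambda>\<omega>. \<Sum>p\<in>E. c p * G p \<omega>) (\<Sum>p\<in>E. \<Sum>q\<in>E. c p * c q * edge_cov r p q)"
        using centered_gaussian_field_subset[OF field E finite_pairs]
        unfolding centered_gaussian_field_def by blast
      show "0 \<le> (\<Sum>p\<in>E. \<Sum>q\<in>E. c p * c q * edge_cov r p q)"
        unfolding edge_cov_quadratic_form[OF E] using r
        by (intro add_nonneg_nonneg mult_nonneg_nonneg sum_nonneg) auto
    qed
  qed
  thus ?thesis by (simp only: prob_edge_value_le[OF E])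
qed

section \<open>Poisson approximation for the conditional product\<close>

lemma integral_exp_std_normal:
  "integrable std_normal_distribution (\<lambda>x. exp (a * x))"
  "(LINT x|std_normal_distribution. exp (a * x)) = exp (a\<^sup>2 / 2)"
proof -
  \<comment> \<open>Completing the square: tilting by \<open>exp (a * x)\<close> shifts the mean
    from 0 to \<open>a\<close>.\<close>
  have eq: "std_normal_density x * exp (a * x) = exp (a\<^sup>2 / 2) * normal_density a 1 x" for x
    by (simp add: normal_density_def exp_add[symmetric] power2_eq_square field_simps)
  have *: "has_bochner_integral std_normal_distribution (\<lambda>x. exp (a * x)) (exp (a\<^sup>2 / 2) * 1)"
  proof (rule has_bochner_integral_density)
    have "has_bochner_integral lborel (normal_density a 1) 1"
      using integral_normal_density[of 1 a] integrable_normal_density[of 1 a] by (simp add: has_bochner_integral_iff)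
    from has_bochner_integral_mult_right[OF this, of "exp (a\<^sup>2 / 2)"]
    show "has_bochner_integral lborel (\<lambda>x. std_normal_density x *\<^sub>R exp (a * x)) (exp (a\<^sup>2 / 2) * 1)"
      by (simp add: eq)
  qed auto
  from * show "integrable std_normal_distribution (\<lambda>x. exp (a * x))"
    "(LINT x|std_normal_distribution. exp (a * x)) = exp (a\<^sup>2 / 2)"
    by (simp_all add: has_bochner_integral_iff)
qed

lemma integral_exp_std_normal_product:
  assumes "finite I" "J \<subseteq> I"
  shows "integrable (std_normal_product I) (\<lambda>x. exp (\<Sum>i\<in>J. a i * x i))"
    and "(LINT x|std_normal_product I. exp (\<Sum>i\<in>J. a i * x i)) = exp ((\<Sum>i\<in>J. (a i)\<^sup>2) / 2)"
proof -
  interpret product_sigma_finite "\<lambda>_. std_normal_distribution" by (rule product_sigma_finite_std_normal)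
  define b where "b i = (if i \<in> J then a i else 0)" for i
  have b: "(\<Sum>i\<in>J. a i * x i) = (\<Sum>i\<in>I. b i * x i)" "(\<Sum>i\<in>J. (a i)\<^sup>2) = (\<Sum>i\<in>I. (b i)\<^sup>2)" for x
    using assms by (auto simp: b_def intro!: sum.mono_neutral_cong_left)
  have eq: "exp (\<Sum>i\<in>J. a i * x i) = (\<Prod>i\<in>I. exp (b i * x i))" for x
    using assms by (simp add: b exp_sum)
  show "integrable (std_normal_product I) (\<lambda>x. exp (\<Sum>i\<in>J. a i * x i))"
    unfolding eq using assms by (intro product_integrable_prod integral_exp_std_normal)
  show "(LINT x|std_normal_product I. exp (\<Sum>i\<in>J. a i * x i)) = exp ((\<Sum>i\<in>J. (a i)\<^sup>2) / 2)"
    unfolding eq unfolding b using assms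
    by (subst product_integral_prod)
       (auto intro!: integral_exp_std_normal
             simp: integral_exp_std_normal exp_sum sum_divide_distrib)
qed

text \<open>Given the vertices, the edge is normal with mean \<open>sqrt r * s\<close> and variance
  \<open>1 - 2 * r\<close>; this is the exponential Markov inequality. The bound holds for every
  \<open>s\<close> and is exponential in \<open>s\<close>, so integrating it over the vertices only
  involves Gaussian exponential moments.\<close>

lemma edge_tail_chernoff:
  assumes "\<theta> \<ge> 0" "r \<le> 1/2"
  shows "edge_tail r u s \<le> exp (- \<theta> * (u - sqrt r * s) + \<theta>\<^sup>2 * (1 - 2 * r) / 2)"
proof -
  interpret prob_space std_normal_distribution by (rule prob_space_std_normal_distribution)
  let ?A = "{z. u < sqrt r * s + sqrt (1 - 2 * r) * z}"
  have "edge_tail r u s = (LINT z|std_normal_distribution. indicat_real ?A z)"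
    by (simp add: edge_tail_def)
  also have "\<dots> \<le> (LINT z|std_normal_distribution. exp (\<theta> * (sqrt r * s - u)) * exp ((\<theta> * sqrt (1 - 2 * r)) * z))"
  proof (rule integral_mono)
    show "indicat_real ?A z \<le> exp (\<theta> * (sqrt r * s - u)) * exp ((\<theta> * sqrt (1 - 2 * r)) * z)" for z
    proof (cases "z \<in> ?A")
      case True
      hence "0 \<le> \<theta> * (sqrt r * s + sqrt (1 - 2 * r) * z - u)"
        using assms(1) by (intro mult_nonneg_nonneg) auto
      thus ?thesis using True by (simp add: exp_add[symmetric] algebra_simps)
    qed auto
  qed (auto intro!: integrable_const_bound[where B=1] integrable_mult_right integral_exp_std_normal)
  also have "\<dots> = exp (\<theta> * (sqrt r * s - u)) * exp ((\<theta> * sqrt (1 - 2 * r))\<^sup>2 / 2)"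
    by (simp only: integral_mult_right_zero integral_exp_std_normal)
  also have "\<dots> = exp (- \<theta> * (u - sqrt r * s) + \<theta>\<^sup>2 * (1 - 2 * r) / 2)"
    using assms(2) by (simp add: exp_add[symmetric] power_mult_distrib algebra_simps)
  finally show ?thesis .
qed

text \<open>\<open>h\<close> is the truncation of \<open>f\<close>, uniformly below
  \<open>\<eta>\<close> and with variance of the sum at most \<open>b\<close>. On \<open>A\<close>
  the two agree, and \<open>exp (- y / (1 - \<eta>)) \<le> 1 - y \<le> exp (- y)\<close> for
  \<open>y\<close> in [0, \<open>\<eta>\<close>] puts the product between two exponentials of the
  sum \<open>S\<close>. As \<open>exp (- y)\<close> is 1-Lipschitz on the nonnegative reals, the
  error is controlled by the mean of \<open>\<bar>S - l\<bar>\<close>. Off \<open>A\<close> the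
  error is at most 1.\<close>

lemma (in prob_space) expectation_prod_poisson_approx:
  fixes f h :: "'i \<Rightarrow> 'a \<Rightarrow> real"
  assumes I: "finite I" and A: "A \<in> events"
    and [measurable]: "\<And>p. p \<in> I \<Longrightarrow> f p \<in> borel_measurable M" "\<And>p. p \<in> I \<Longrightarrow> h p \<in> borel_measurable M"
    and f: "\<And>p \<omega>. 0 \<le> f p \<omega>" "\<And>p \<omega>. f p \<omega> \<le> 1"
    and h: "\<And>p \<omega>. 0 \<le> h p \<omega>" "\<And>p \<omega>. h p \<omega> \<le> \<eta>" and \<eta>: "\<eta> < 1" and l: "l \<ge> 0"
    and fh: "\<And>p \<omega>. p \<in> I \<Longrightarrow> \<omega> \<in> A \<Longrightarrow> f p \<omega> = h p \<omega>"
    and second: "expectation (\<lambda>\<omega>. (\<Sum>p\<in>I. h p \<omega>)\<^sup>2) \<le> (expectation (\<lambda>\<omega>. \<Sum>p\<in>I. h p \<omega>))\<^sup>2 + b"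
  shows "\<bar>expectation (\<lambda>\<omega>. \<Prod>p\<in>I. 1 - f p \<omega>) - exp (- l)\<bar> \<le>
     prob (space M - A) + (\<bar>expectation (\<lambda>\<omega>. \<Sum>p\<in>I. h p \<omega>) - l\<bar> + sqrt b + l * \<eta>) / (1 - \<eta>)"
proof -
  define S where "S = (\<lambda>\<omega>. \<Sum>p\<in>I. h p \<omega>)"
  define m where "m = expectation S"
  have \<eta>0: "\<eta> \<ge> 0" using h[of undefined undefined] by linarith
  have [measurable]: "S \<in> borel_measurable M" unfolding S_def by auto
  have S: "0 \<le> S \<omega>" "S \<omega> \<le> card I * \<eta>" for \<omega>
    unfolding S_def using h sum_bounded_above[of I "\<lambda>p. h p \<omega>" \<eta>] by (auto intro!: sum_nonneg)
  have intS: "integrable M S" using S by (intro integrable_const_bound[where B="card I * \<eta>"]) auto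
  have intS2: "integrable M (\<lambda>\<omega>. (S \<omega>)\<^sup>2)"
    using S by (intro integrable_const_bound[where B="(card I * \<eta>)\<^sup>2"]) (auto intro!: power_mono)
  have intY: "integrable M (\<lambda>\<omega>. \<bar>S \<omega> - m\<bar>)" using intS by auto
  have sq: "(S \<omega> - m)\<^sup>2 = (S \<omega>)\<^sup>2 - 2 * m * S \<omega> + m\<^sup>2" for \<omega>
    by (simp add: power2_eq_square algebra_simps)
  have intY2: "integrable M (\<lambda>\<omega>. \<bar>S \<omega> - m\<bar>\<^sup>2)"
    using intS intS2 by (simp add: sq)
  have "expectation (\<lambda>\<omega>. \<bar>S \<omega> - m\<bar>\<^sup>2) = expectation (\<lambda>\<omega>. (S \<omega>)\<^sup>2) - m\<^sup>2"
    using intS intS2 by (simp add: sq m_def prob_space power2_eq_square algebra_simps)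
  hence "expectation (\<lambda>\<omega>. \<bar>S \<omega> - m\<bar>\<^sup>2) \<le> b"
    using second by (simp add: S_def m_def)
  \<comment> \<open>Nonnegativity of this variance is the Cauchy-Schwarz inequality that bounds the
    first absolute moment by \<open>sqrt b\<close>.\<close>
  moreover have "variance (\<lambda>\<omega>. \<bar>S \<omega> - m\<bar>) \<ge> 0" by (rule variance_positive)
  ultimately have "(expectation (\<lambda>\<omega>. \<bar>S \<omega> - m\<bar>))\<^sup>2 \<le> b"
    by (simp add: variance_eq[OF intY intY2])
  hence EY: "expectation (\<lambda>\<omega>. \<bar>S \<omega> - m\<bar>) \<le> sqrt b"
    by (rule real_le_rsqrt)
  have explip: "exp (- x) - exp (- y) \<le> \<bar>x - y\<bar>" if "x \<ge> 0" "y \<ge> 0" for x y :: real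
  proof (cases "x \<le> y")
    case True
    have "exp (- x) - exp (- y) = exp (- x) * (1 - exp (- (y - x)))"
      by (simp add: algebra_simps exp_add[symmetric])
    also have "\<dots> \<le> 1 * (y - x)"
    proof (rule mult_mono)
      show "1 - exp (- (y - x)) \<le> y - x" using exp_ge_add_one_self[of "- (y - x)"] by linarith
    qed (use that True in auto)
    finally show ?thesis using True by simp
  next
    case False
    hence "exp (- x) \<le> exp (- y)" by simp
    thus ?thesis by linarith
  qed
  have f01: "0 \<le> (\<Prod>p\<in>I. 1 - f p \<omega>)" "(\<Prod>p\<in>I. 1 - f p \<omega>) \<le> 1" for \<omega>
    using f by (auto intro!: prod_nonneg prod_le_1)
  have pw: "\<bar>(\<Prod>p\<in>I. 1 - f p \<omega>) - exp (- l)\<bar> \<le>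
      indicator (space M - A) \<omega> + (\<bar>S \<omega> - m\<bar> + (\<bar>m - l\<bar> + l * \<eta>)) / (1 - \<eta>)" if "\<omega> \<in> space M" for \<omega>
  proof (cases "\<omega> \<in> A")
    case False
    have "\<bar>(\<Prod>p\<in>I. 1 - f p \<omega>) - exp (- l)\<bar> \<le> 1"
    proof -
      have "0 \<le> exp (- l)" "exp (- l) \<le> 1" using l by simp_all
      thus ?thesis using f01[of \<omega>] by linarith
    qed
    moreover have "0 \<le> (\<bar>S \<omega> - m\<bar> + (\<bar>m - l\<bar> + l * \<eta>)) / (1 - \<eta>)" using \<eta> \<eta>0 l by auto
    ultimately show ?thesis using False that by simp
  next
    case True
    let ?P = "\<Prod>p\<in>I. 1 - h p \<omega>"
    have "?P \<le> (\<Prod>p\<in>I. exp (- h p \<omega>))"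
    proof (intro prod_mono conjI)
      fix p
      show "0 \<le> 1 - h p \<omega>" using h[of p \<omega>] \<eta> by linarith
      show "1 - h p \<omega> \<le> exp (- h p \<omega>)" using exp_ge_add_one_self[of "- h p \<omega>"] by simp
    qed
    also have "\<dots> = exp (- S \<omega>)" using I by (simp add: exp_sum[symmetric] S_def sum_negf)
    finally have up: "?P \<le> exp (- S \<omega>)" .
    have "exp (- (S \<omega> / (1 - \<eta>))) = (\<Prod>p\<in>I. exp (- (h p \<omega> / (1 - \<eta>))))"
      using I by (simp add: exp_sum[symmetric] S_def sum_negf sum_divide_distrib)
    also have "\<dots> \<le> ?P"
    proof (intro prod_mono conjI)
      fix p
      have "1 / (1 - h p \<omega>) = 1 + h p \<omega> / (1 - h p \<omega>)" using h[of p \<omega>] \<eta> by (simp add: field_simps)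
      also have "\<dots> \<le> 1 + h p \<omega> / (1 - \<eta>)"
        using h[of p \<omega>] \<eta> by (intro add_left_mono divide_left_mono) auto
      also have "\<dots> \<le> exp (h p \<omega> / (1 - \<eta>))" by (rule exp_ge_add_one_self)
      finally show "exp (- (h p \<omega> / (1 - \<eta>))) \<le> 1 - h p \<omega>"
        using h[of p \<omega>] \<eta> by (simp add: exp_minus field_simps)
    qed auto
    finally have lo: "exp (- (S \<omega> / (1 - \<eta>))) \<le> ?P" .
    have "?P - exp (- l) \<le> \<bar>S \<omega> - l\<bar>" using up explip[OF S(1) l, of \<omega>] by linarith
    also have "\<dots> \<le> (\<bar>S \<omega> - l\<bar> + l * \<eta>) / (1 - \<eta>)"
    proof -
      have "\<bar>S \<omega> - l\<bar> * (1 - \<eta>) \<le> \<bar>S \<omega> - l\<bar> * 1" using \<eta>0 by (intro mult_left_mono) auto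
      thus ?thesis using \<eta> \<eta>0 l by (simp add: pos_le_divide_eq add_increasing2)
    qed
    finally have 1: "?P - exp (- l) \<le> (\<bar>S \<omega> - l\<bar> + l * \<eta>) / (1 - \<eta>)" .
    \<comment> \<open>The lower exponential has \<open>S / (1 - \<eta>)\<close> in place of
      \<open>S\<close>; comparing it with \<open>l\<close> produces the term
      \<open>l * \<eta>\<close> and the denominator.\<close>
    have "exp (- l) - ?P \<le> \<bar>l - S \<omega> / (1 - \<eta>)\<bar>"
      using lo explip[OF l, of "S \<omega> / (1 - \<eta>)"] S(1)[of \<omega>] \<eta> by simp
    also have "\<dots> = \<bar>(l - S \<omega>) - l * \<eta>\<bar> / (1 - \<eta>)"
    proof -
      have "l - S \<omega> / (1 - \<eta>) = ((l - S \<omega>) - l * \<eta>) / (1 - \<eta>)" using \<eta> by (simp add: field_simps)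
      thus ?thesis using \<eta> by (simp add: abs_divide)
    qed
    also have "\<dots> \<le> (\<bar>S \<omega> - l\<bar> + l * \<eta>) / (1 - \<eta>)"
    proof (rule divide_right_mono)
      have "0 \<le> l * \<eta>" using \<eta>0 l by simp
      thus "\<bar>(l - S \<omega>) - l * \<eta>\<bar> \<le> \<bar>S \<omega> - l\<bar> + l * \<eta>" by linarith
    qed (use \<eta> in simp)
    finally have 2: "exp (- l) - ?P \<le> (\<bar>S \<omega> - l\<bar> + l * \<eta>) / (1 - \<eta>)" .
    have "(\<bar>S \<omega> - l\<bar> + l * \<eta>) / (1 - \<eta>) \<le> (\<bar>S \<omega> - m\<bar> + (\<bar>m - l\<bar> + l * \<eta>)) / (1 - \<eta>)"
      using \<eta> by (intro divide_right_mono) auto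
    moreover have "(\<Prod>p\<in>I. 1 - f p \<omega>) = ?P" using fh True by (intro prod.cong) auto
    ultimately show ?thesis using 1 2 True by (simp add: abs_le_iff)
  qed
  have intf: "integrable M (\<lambda>\<omega>. \<Prod>p\<in>I. 1 - f p \<omega>)"
    using f01 by (intro integrable_const_bound[where B=1]) auto
  have intr: "integrable M (\<lambda>\<omega>. (\<bar>S \<omega> - m\<bar> + (\<bar>m - l\<bar> + l * \<eta>)) / (1 - \<eta>))"
    using intY by auto
  have inti: "integrable M (indicat_real (space M - A))"
    using A by (intro integrable_const_bound[where B=1]) auto
  have "\<bar>expectation (\<lambda>\<omega>. \<Prod>p\<in>I. 1 - f p \<omega>) - exp (- l)\<bar> = \<bar>expectation (\<lambda>\<omega>. (\<Prod>p\<in>I. 1 - f p \<omega>) - exp (- l))\<bar>"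
    using intf by (simp add: prob_space)
  also have "\<dots> \<le> expectation (\<lambda>\<omega>. \<bar>(\<Prod>p\<in>I. 1 - f p \<omega>) - exp (- l)\<bar>)"
    by (rule integral_abs_bound)
  also have "\<dots> \<le> expectation (\<lambda>\<omega>. indicator (space M - A) \<omega> + (\<bar>S \<omega> - m\<bar> + (\<bar>m - l\<bar> + l * \<eta>)) / (1 - \<eta>))"
    using intf intr inti by (intro integral_mono pw Bochner_Integration.integrable_add) auto
  also have "\<dots> = prob (space M - A) + expectation (\<lambda>\<omega>. (\<bar>S \<omega> - m\<bar> + (\<bar>m - l\<bar> + l * \<eta>)) / (1 - \<eta>))"
    using inti intr A by (subst Bochner_Integration.integral_add) auto
  also have "expectation (\<lambda>\<omega>. (\<bar>S \<omega> - m\<bar> + (\<bar>m - l\<bar> + l * \<eta>)) / (1 - \<eta>)) =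
      (expectation (\<lambda>\<omega>. \<bar>S \<omega> - m\<bar>) + (\<bar>m - l\<bar> + l * \<eta>)) / (1 - \<eta>)"
    using intY by (simp add: prob_space)
  also have "\<dots> \<le> (\<bar>m - l\<bar> + sqrt b + l * \<eta>) / (1 - \<eta>)"
    using EY \<eta> by (intro divide_right_mono) auto
  finally show ?thesis unfolding m_def S_def by simp
qed

section \<open>First and second moments of the truncated conditional probabilities\<close>

lemma integral_exp_two_coordinates:
  fixes n i j :: nat
  assumes "i \<in> {1..n}" "j \<in> {1..n}" "i \<noteq> j"
  shows "integrable (std_normal_product {1..n}) (\<lambda>x. exp (k + a * x i + b * x j))"
    and "(LINT x|std_normal_product {1..n}. exp (k + a * x i + b * x j)) = exp (k + (a\<^sup>2 + b\<^sup>2) / 2)"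
proof -
  let ?c = "\<lambda>m. if m = i then a else b"
  have eq: "exp (k + a * x i + b * x j) = exp k * exp (\<Sum>m\<in>{i, j}. ?c m * x m)" for x :: "nat \<Rightarrow> real"
    using assms by (simp add: exp_add[symmetric] add_ac)
  have "{i, j} \<subseteq> {1..n}" using assms by auto
  note * = integral_exp_std_normal_product[OF finite_atLeastAtMost this, of ?c]
  show "integrable (std_normal_product {1..n}) (\<lambda>x. exp (k + a * x i + b * x j))"
    unfolding eq by (intro integrable_mult_right *)
  show "(LINT x|std_normal_product {1..n}. exp (k + a * x i + b * x j)) = exp (k + (a\<^sup>2 + b\<^sup>2) / 2)"
    unfolding eq integral_mult_right_zero *(2) using assms by (simp add: exp_add[symmetric])
qed

lemma integral_exp_three_coordinates:
  fixes n i j l :: nat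
  assumes "i \<in> {1..n}" "j \<in> {1..n}" "l \<in> {1..n}" "i \<noteq> j" "i \<noteq> l" "j \<noteq> l"
  shows "integrable (std_normal_product {1..n}) (\<lambda>x. exp (k + a * x i + b * x j + c * x l))"
    and "(LINT x|std_normal_product {1..n}. exp (k + a * x i + b * x j + c * x l)) =
           exp (k + (a\<^sup>2 + b\<^sup>2 + c\<^sup>2) / 2)"
proof -
  let ?c = "\<lambda>m. if m = i then a else if m = j then b else c"
  have eq: "exp (k + a * x i + b * x j + c * x l) = exp k * exp (\<Sum>m\<in>{i, j, l}. ?c m * x m)" for x :: "nat \<Rightarrow> real"
    using assms by (simp add: exp_add[symmetric] add_ac)
  have "{i, j, l} \<subseteq> {1..n}" using assms by auto
  note * = integral_exp_std_normal_product[OF finite_atLeastAtMost this, of ?c]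
  show "integrable (std_normal_product {1..n}) (\<lambda>x. exp (k + a * x i + b * x j + c * x l))"
    unfolding eq by (intro integrable_mult_right *)
  show "(LINT x|std_normal_product {1..n}. exp (k + a * x i + b * x j + c * x l)) =
           exp (k + (a\<^sup>2 + b\<^sup>2 + c\<^sup>2) / 2)"
    unfolding eq integral_mult_right_zero *(2) using assms by (simp add: exp_add[symmetric] add_ac)
qed

lemma measurable_edge_tail_sum:
  assumes "i \<in> I" "j \<in> I"
  shows "(\<lambda>x. edge_tail r u (x i + x j)) \<in> borel_measurable (std_normal_product I)"
  by (intro measurable_compose[OF _ borel_measurable_edge_tail] borel_measurable_add
        measurable_component_std_normal assms)

lemma sets_coordinate_le:
  assumes "i \<in> I"
  shows "{x\<in>space (std_normal_product I). x i \<le> t} \<in> sets (std_normal_product I)"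
    "{x\<in>space (std_normal_product I). t < x i} \<in> sets (std_normal_product I)"
  by (intro borel_measurable_le borel_measurable_less borel_measurable_const measurable_component_std_normal assms)+

lemma measurable_indicator_coordinate:
  assumes "i \<in> I"
  shows "(\<lambda>x. indicat_real {..t} (x i)) \<in> borel_measurable (std_normal_product I)"
    "(\<lambda>x. indicat_real {t<..} (x i)) \<in> borel_measurable (std_normal_product I)"
  by (rule measurable_compose[OF measurable_component_std_normal[OF assms]], simp)+

text \<open>With Chernoff parameter \<open>u\<close> for the edge, the tilted law of
  \<open>x i\<close> has mean \<open>sqrt r * u\<close>. Requiring \<open>x i\<close> to exceed the
  larger value \<open>t\<close> costs the additional Gaussian factor
  \<open>exp (- (t - sqrt r * u)\<^sup>2 / 2)\<close>.\<close>

lemma edge_tail_excess_le: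
  fixes n i j :: nat
  assumes "i \<in> {1..n}" "j \<in> {1..n}" "i \<noteq> j" and r: "0 \<le> r" "r \<le> 1/2"
    and "0 \<le> u" "sqrt r * u \<le> t"
  shows "(LINT x|std_normal_product {1..n}. edge_tail r u (x i + x j) * indicat_real {t<..} (x i)) \<le>
           exp (- u\<^sup>2 / 2 - (t - sqrt r * u)\<^sup>2 / 2)"
proof -
  interpret prob_space "std_normal_product {1..n}" by (rule prob_space_std_normal_product)
  \<comment> \<open>With this \<open>\<beta>\<close> the total tilt of \<open>x i\<close>, namely
    \<open>u * sqrt r + \<beta>\<close>, equals \<open>t\<close>.\<close>
  define \<beta> where "\<beta> = t - sqrt r * u"
  have \<beta>: "\<beta> \<ge> 0" using assms by (simp add: \<beta>_def)
  let ?k = "- u\<^sup>2 + u\<^sup>2 * (1 - 2 * r) / 2 - \<beta> * t"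
  have "(LINT x|std_normal_product {1..n}. edge_tail r u (x i + x j) * indicat_real {t<..} (x i)) \<le>
        (LINT x|std_normal_product {1..n}. exp (?k + (u * sqrt r + \<beta>) * x i + (u * sqrt r) * x j))"
  proof (rule integral_mono)
    show "integrable (std_normal_product {1..n}) (\<lambda>x. edge_tail r u (x i + x j) * indicat_real {t<..} (x i))"
    proof (rule integrable_const_bound[where B=1])
      show "(\<lambda>x. edge_tail r u (x i + x j) * indicat_real {t<..} (x i)) \<in> borel_measurable (std_normal_product {1..n})"
        by (intro borel_measurable_times measurable_edge_tail_sum measurable_indicator_coordinate assms)
    qed (use edge_tail_bounds in \<open>auto simp: indicator_def\<close>)
    show "edge_tail r u (x i + x j) * indicat_real {t<..} (x i) \<le>
        exp (?k + (u * sqrt r + \<beta>) * x i + (u * sqrt r) * x j)" for x :: "nat \<Rightarrow> real"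
    proof (cases "t < x i")
      case True
      have "edge_tail r u (x i + x j) \<le> exp (- u * (u - sqrt r * (x i + x j)) + u\<^sup>2 * (1 - 2 * r) / 2)"
        using assms by (intro edge_tail_chernoff) auto
      also have "\<dots> \<le> exp (- u * (u - sqrt r * (x i + x j)) + u\<^sup>2 * (1 - 2 * r) / 2 + \<beta> * (x i - t))"
        using True \<beta> by simp
      also have "\<dots> = exp (?k + (u * sqrt r + \<beta>) * x i + (u * sqrt r) * x j)"
        by (simp add: algebra_simps power2_eq_square)
      finally show ?thesis using True by simp
    qed auto
  qed (intro integral_exp_two_coordinates assms)
  also have "\<dots> = exp (?k + ((u * sqrt r + \<beta>)\<^sup>2 + (u * sqrt r)\<^sup>2) / 2)"
    by (intro integral_exp_two_coordinates assms)
  also have "?k + ((u * sqrt r + \<beta>)\<^sup>2 + (u * sqrt r)\<^sup>2) / 2 = - u\<^sup>2 / 2 - (t - sqrt r * u)\<^sup>2 / 2"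
  proof -
    have "u * sqrt r + \<beta> = t" by (simp add: \<beta>_def)
    thus ?thesis using r by (simp only:) (simp add: \<beta>_def power_mult_distrib power2_diff field_simps power2_eq_square[of t])
  qed
  finally show ?thesis .
qed

text \<open>Each edge is bounded with Chernoff parameter \<open>\<theta>\<close>, and the indicator
  of \<open>x i \<le> t\<close> by \<open>exp (\<beta> * (t - x i))\<close>. The tilt
  \<open>2 * \<theta> * sqrt r\<close> of the common vertex is thereby reduced by
  \<open>\<beta>\<close>, which is the gain from the truncation.\<close>

lemma edge_tail_pair_le:
  fixes n i j :: nat
  assumes "i \<in> {1..n}" "j \<in> {1..n}" "l \<in> {1..n}" "i \<noteq> j" "i \<noteq> l" "j \<noteq> l" and r: "0 \<le> r" "r \<le> 1/2"
    and "0 \<le> \<theta>" "0 \<le> \<beta>"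
  shows "(LINT x|std_normal_product {1..n}. edge_tail r u (x i + x j) * edge_tail r u (x i + x l) * indicat_real {..t} (x i)) \<le>
           exp (- 2 * \<theta> * u + \<theta>\<^sup>2 * (1 - r) + \<beta> * t + (2 * \<theta> * sqrt r - \<beta>)\<^sup>2 / 2)"
proof -
  interpret prob_space "std_normal_product {1..n}" by (rule prob_space_std_normal_product)
  let ?k = "- 2 * \<theta> * u + \<theta>\<^sup>2 * (1 - 2 * r) + \<beta> * t"
  have "(LINT x|std_normal_product {1..n}. edge_tail r u (x i + x j) * edge_tail r u (x i + x l) * indicat_real {..t} (x i)) \<le>
        (LINT x|std_normal_product {1..n}. exp (?k + (2 * \<theta> * sqrt r - \<beta>) * x i + (\<theta> * sqrt r) * x j + (\<theta> * sqrt r) * x l))"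
  proof (rule integral_mono)
    show "integrable (std_normal_product {1..n})
        (\<lambda>x. edge_tail r u (x i + x j) * edge_tail r u (x i + x l) * indicat_real {..t} (x i))"
    proof (rule integrable_const_bound[where B=1])
      show "(\<lambda>x. edge_tail r u (x i + x j) * edge_tail r u (x i + x l) * indicat_real {..t} (x i))
          \<in> borel_measurable (std_normal_product {1..n})"
        by (intro borel_measurable_times measurable_edge_tail_sum measurable_indicator_coordinate assms)
    qed (use edge_tail_bounds in \<open>auto simp: indicator_def abs_mult intro!: mult_le_one\<close>)
    show "edge_tail r u (x i + x j) * edge_tail r u (x i + x l) * indicat_real {..t} (x i) \<le>
        exp (?k + (2 * \<theta> * sqrt r - \<beta>) * x i + (\<theta> * sqrt r) * x j + (\<theta> * sqrt r) * x l)" for x :: "nat \<Rightarrow> real"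
    proof (cases "x i \<le> t")
      case True
      have "edge_tail r u (x i + x j) * edge_tail r u (x i + x l) \<le>
          exp (- \<theta> * (u - sqrt r * (x i + x j)) + \<theta>\<^sup>2 * (1 - 2 * r) / 2) *
          exp (- \<theta> * (u - sqrt r * (x i + x l)) + \<theta>\<^sup>2 * (1 - 2 * r) / 2)"
        using assms by (intro mult_mono edge_tail_chernoff edge_tail_bounds) auto
      also have "\<dots> = exp ((- \<theta> * (u - sqrt r * (x i + x j)) + \<theta>\<^sup>2 * (1 - 2 * r) / 2) +
          (- \<theta> * (u - sqrt r * (x i + x l)) + \<theta>\<^sup>2 * (1 - 2 * r) / 2))"
        by (rule exp_add[symmetric])
      also have "\<dots> \<le> exp ((- \<theta> * (u - sqrt r * (x i + x j)) + \<theta>\<^sup>2 * (1 - 2 * r) / 2) +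
          (- \<theta> * (u - sqrt r * (x i + x l)) + \<theta>\<^sup>2 * (1 - 2 * r) / 2) + \<beta> * (t - x i))"
        using True \<open>\<beta> \<ge> 0\<close> by simp
      also have "\<dots> = exp (?k + (2 * \<theta> * sqrt r - \<beta>) * x i + (\<theta> * sqrt r) * x j + (\<theta> * sqrt r) * x l)"
        by (simp add: field_simps)
      finally show ?thesis using True by simp
    qed auto
  qed (intro integral_exp_three_coordinates assms)
  also have "\<dots> = exp (?k + ((2 * \<theta> * sqrt r - \<beta>)\<^sup>2 + (\<theta> * sqrt r)\<^sup>2 + (\<theta> * sqrt r)\<^sup>2) / 2)"
    by (intro integral_exp_three_coordinates assms)
  also have "?k + ((2 * \<theta> * sqrt r - \<beta>)\<^sup>2 + (\<theta> * sqrt r)\<^sup>2 + (\<theta> * sqrt r)\<^sup>2) / 2 =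
      - 2 * \<theta> * u + \<theta>\<^sup>2 * (1 - r) + \<beta> * t + (2 * \<theta> * sqrt r - \<beta>)\<^sup>2 / 2"
    using r by (simp add: power_mult_distrib field_simps)
  finally show ?thesis .
qed

section \<open>Independence and counting of edges\<close>

lemma indep_vars_std_normal_product:
  "prob_space.indep_vars (std_normal_product I) (\<lambda>_. std_normal_distribution) (\<lambda>i x. x i) I"
proof (cases "I = {}")
  case True
  thus ?thesis
    by (simp add: prob_space.indep_vars_def[OF prob_space_std_normal_product]
          prob_space.indep_sets_def[OF prob_space_std_normal_product])
next
  case False
  let ?P = "std_normal_product I"
  interpret prob_space ?P by (rule prob_space_std_normal_product)
  have "distr ?P ?P (\<lambda>x. \<lambda>i\<in>I. x i) = distr ?P ?P (\<lambda>x. x)"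
    by (intro distr_cong refl) (auto simp: space_PiM)
  moreover have "Pi\<^sub>M I (\<lambda>i. distr ?P std_normal_distribution (\<lambda>x. x i)) = ?P"
    by (intro PiM_cong refl distr_PiM_component prob_space_std_normal_distribution)
  ultimately show ?thesis
    using False by (subst indep_vars_iff_distr_eq_PiM') (auto simp: distr_id)
qed

text \<open>Used for edges without a common vertex: they depend on disjoint blocks of independent
  coordinates and contribute nothing to the variance.\<close>

lemma integral_mult_disjoint_coordinates:
  fixes F :: "real \<Rightarrow> real \<Rightarrow> real"
  assumes "i \<in> I" "j \<in> I" "k \<in> I" "l \<in> I" "{i, j} \<inter> {k, l} = {}"
    and F: "(\<lambda>(x, y). F x y) \<in> borel_measurable (borel \<Otimes>\<^sub>M borel)" "\<And>x y. \<bar>F x y\<bar> \<le> B"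
  shows "(LINT x|std_normal_product I. F (x i) (x j) * F (x k) (x l)) =
    (LINT x|std_normal_product I. F (x i) (x j)) * (LINT x|std_normal_product I. F (x k) (x l))"
proof -
  let ?P = "std_normal_product I"
  interpret prob_space ?P by (rule prob_space_std_normal_product)
  have meas: "(\<lambda>x. F (x a) (x b)) \<in> borel_measurable (std_normal_product J)" if "a \<in> J" "b \<in> J" for a b and J :: "'a set"
    using measurable_compose[OF measurable_Pair[OF measurable_component_std_normal[OF that(1)]
        measurable_component_std_normal[OF that(2)]] F(1)] by simp
  have 1: "indep_var (std_normal_product {i, j}) (\<lambda>x. restrict (\<lambda>a. x a) {i, j})
      (std_normal_product {k, l}) (\<lambda>x. restrict (\<lambda>a. x a) {k, l})"
    using assms by (intro indep_var_restrict[OF indep_vars_std_normal_product]) auto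
  have "indep_var borel ((\<lambda>x. F (x i) (x j)) \<circ> (\<lambda>x. restrict (\<lambda>a. x a) {i, j}))
      borel ((\<lambda>x. F (x k) (x l)) \<circ> (\<lambda>x. restrict (\<lambda>a. x a) {k, l}))"
    by (intro indep_var_compose[OF 1] meas) auto
  hence "indep_var borel (\<lambda>x. F (x i) (x j)) borel (\<lambda>x. F (x k) (x l))"
    by (simp add: comp_def)
  moreover have "integrable ?P (\<lambda>x. F (x a) (x b))" if "a \<in> I" "b \<in> I" for a b
    using F(2) meas[OF that] by (intro integrable_const_bound[where B=B]) auto
  ultimately show ?thesis using assms by (intro indep_var_lebesgue_integral) auto
qed

text \<open>An incident edge is determined by the shared endpoint of \<open>p\<close>, two choices,
  and its other endpoint, at most \<open>n\<close> choices; \<open>min\<close> and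
  \<open>max\<close> restore the order. The pair \<open>p\<close> itself is counted.\<close>

lemma card_incident_pairs:
  assumes "p \<in> pairs n"
  shows "card {q\<in>pairs n. {fst p, snd p} \<inter> {fst q, snd q} \<noteq> {}} \<le> 2 * n"
proof -
  have "{q\<in>pairs n. {fst p, snd p} \<inter> {fst q, snd q} \<noteq> {}} \<subseteq>
      (\<lambda>(a, b). (min a b, max a b)) ` ({fst p, snd p} \<times> {1..n})"
  proof
    fix q assume q: "q \<in> {q\<in>pairs n. {fst p, snd p} \<inter> {fst q, snd q} \<noteq> {}}"
    then obtain a b where ab: "q = (a, b)" "1 \<le> a" "a < b" "b \<le> n" by (auto simp: pairs_def)
    have "a \<in> {fst p, snd p} \<or> b \<in> {fst p, snd p}" using q ab by auto
    thus "q \<in> (\<lambda>(a, b). (min a b, max a b)) ` ({fst p, snd p} \<times> {1..n})"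
    proof
      assume "a \<in> {fst p, snd p}"
      thus ?thesis using ab by (intro image_eqI[of _ _ "(a, b)"]) auto
    next
      assume "b \<in> {fst p, snd p}"
      thus ?thesis using ab by (intro image_eqI[of _ _ "(b, a)"]) auto
    qed
  qed
  hence "card {q\<in>pairs n. {fst p, snd p} \<inter> {fst q, snd q} \<noteq> {}} \<le> card ({fst p, snd p} \<times> {1..n})"
    by (intro surj_card_le) auto
  also have "\<dots> \<le> 2 * n" by (simp add: card_insert_if)
  finally show ?thesis .
qed

lemma card_pairs: "2 * card (pairs n) = n * (n - 1)"
proof (induction n)
  case 0
  have "pairs 0 = {}" by (auto simp: pairs_def)
  thus ?case by simp
next
  case (Suc n)
  have "pairs (Suc n) = pairs n \<union> (\<lambda>i. (i, Suc n)) ` {1..n}"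
    by (auto simp: pairs_def)
  moreover have "card (pairs n \<union> (\<lambda>i. (i, Suc n)) ` {1..n}) = card (pairs n) + n"
    by (subst card_Un_disjoint) (auto simp: finite_pairs card_image inj_on_def, auto simp: pairs_def)
  ultimately show ?case using Suc by (cases n) (auto simp: algebra_simps)
qed

text \<open>An edge variable has variance 1, so its marginal is standard normal. Uniqueness for the
  single index \<open>p\<close> gives this without computing a convolution.\<close>

lemma integral_edge_tail:
  notes One_nat_def [simp del]
  assumes p: "p \<in> pairs n" and r: "0 \<le> r" "r \<le> 1/2"
  shows "(LINT x|std_normal_product {1..n}. edge_tail r u (x (fst p) + x (snd p))) =
         measure std_normal_distribution {u<..}"
proof -
  interpret S: prob_space std_normal_distribution by (rule prob_space_std_normal_distribution)
  interpret P: prob_space "std_normal_product {1..n}" by (rule prob_space_std_normal_product)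
  have E: "{p} \<subseteq> pairs n" using p by simp
  have pV: "fst p \<in> {1..n}" "snd p \<in> {1..n}" using p by (auto simp: pairs_def)
  have cov: "edge_cov r p p = 1" using p by (subst edge_cov_eq[OF p p]) (auto simp: pairs_def)
  have "measure std_normal_distribution {\<omega>\<in>space std_normal_distribution. \<forall>q\<in>{p}. \<omega> \<le> u} =
      measure (vertex_edge_measure n {p}) {\<omega>\<in>space (vertex_edge_measure n {p}). \<forall>q\<in>{p}. edge_value r q \<omega> \<le> u}"
  proof (rule joint_cdf_uniqueness[OF prob_space_std_normal_distribution prob_space_vertex_edge_measure])
    show "edge_value r q \<in> borel_measurable (vertex_edge_measure n {p})" if "q \<in> {p}" for q
      by (rule measurable_edge_value[OF E that])
    show "(CLINT \<omega>|std_normal_distribution. iexp (\<Sum>q\<in>{p}. c q * \<omega>)) =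
        (CLINT \<omega>|vertex_edge_measure n {p}. iexp (\<Sum>q\<in>{p}. c q * edge_value r q \<omega>))" for c
      unfolding integral_iexp_edge_value[OF E r]
      using char_std_normal_distribution by (simp add: char_def fun_eq_iff cov power2_eq_square)
  qed auto
  also have "\<dots> = (LINT x|std_normal_product {1..n}. 1 - edge_tail r u (x (fst p) + x (snd p)))"
    unfolding prob_edge_value_le[OF E] by simp
  also have "\<dots> = 1 - (LINT x|std_normal_product {1..n}. edge_tail r u (x (fst p) + x (snd p)))"
  proof -
    have "integrable (std_normal_product {1..n}) (\<lambda>x. edge_tail r u (x (fst p) + x (snd p)))"
      using edge_tail_bounds measurable_edge_tail_sum[OF pV] by (intro P.integrable_const_bound[where B=1]) auto
    thus ?thesis by (simp add: P.prob_space)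
  qed
  finally have 1: "measure std_normal_distribution {..u} =
      1 - (LINT x|std_normal_product {1..n}. edge_tail r u (x (fst p) + x (snd p)))"
    by (simp add: atMost_def)
  have "{u<..} = space std_normal_distribution - {..u}" by auto
  hence "measure std_normal_distribution {u<..} = 1 - measure std_normal_distribution {..u}"
    by (simp only:) (subst S.prob_compl, auto)
  with 1 show ?thesis by simp
qed

text \<open>The exponent in the bound of \<open>edge_tail_pair_le\<close>: \<open>\<theta>\<close> is the Chernoff parameter of the two edges and
  \<open>\<beta>\<close> the one of the truncation \<open>x i \<le> t\<close> of their common vertex.\<close>

definition pair_exponent :: "real \<Rightarrow> real \<Rightarrow> real \<Rightarrow> real \<Rightarrow> real \<Rightarrow> real" where
  "pair_exponent r u t \<theta> \<beta> =
     - 2 * \<theta> * u + \<theta>\<^sup>2 * (1 - r) + \<beta> * t + (2 * \<theta> * sqrt r - \<beta>)\<^sup>2 / 2"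

text \<open>The bound for fixed \<open>n\<close>, with cutoff \<open>t\<close> for the vertices.
  \<open>\<eta>\<close> bounds a truncated conditional probability, \<open>\<phi>\<close> is its
  untruncated mean, \<open>\<delta>\<close> the mean lost at each endpoint, and
  \<open>\<kappa>\<close> bounds the mixed moment of two edges with one common vertex. Under the
  root, \<open>N * \<phi> * \<eta>\<close> is the diagonal of the variance and
  \<open>N * (2 * n) * \<kappa>\<close> the incident pairs. The assumption
  \<open>2 * sqrt r * t < u\<close> keeps the conditional mean of a truncated edge below the level,
  so that \<open>\<eta> < 1\<close>.\<close>

lemma prob_gaussian_max_le_approx:
  notes One_nat_def [simp del]
  fixes n :: nat and r u t \<theta> \<beta> l \<eta> \<phi> \<delta> \<kappa> N :: real
  defines "\<eta> \<equiv> exp (- (u - 2 * sqrt r * t)\<^sup>2 / 2)"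
    and "\<phi> \<equiv> measure std_normal_distribution {u<..}"
    and "\<delta> \<equiv> exp (- u\<^sup>2 / 2 - (t - sqrt r * u)\<^sup>2 / 2)"
    and "\<kappa> \<equiv> exp (pair_exponent r u t \<theta> \<beta>)"
    and "N \<equiv> real (card (pairs n))"
  assumes M: "prob_space M" "centered_gaussian_field M (pairs n) G (edge_cov r)"
    and r: "0 \<le> r" "r \<le> 1/2" and u: "0 \<le> u" "sqrt r * u \<le> t" "2 * sqrt r * t < u"
    and par: "0 \<le> \<theta>" "0 \<le> \<beta>" "0 \<le> l"
  shows "\<bar>measure M {\<omega>\<in>space M. \<forall>p\<in>pairs n. G p \<omega> \<le> u} - exp (- l)\<bar> \<le>
    n * measure std_normal_distribution {t<..} +
    (\<bar>N * \<phi> - l\<bar> + 2 * N * \<delta> + sqrt (N * \<phi> * \<eta> + N * (2 * n) * \<kappa>) + l * \<eta>) / (1 - \<eta>)"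
proof -
  let ?P = "std_normal_product {1..n}" and ?E = "pairs n"
  interpret P: prob_space ?P by (rule prob_space_std_normal_product)
  define f :: "nat \<times> nat \<Rightarrow> (nat \<Rightarrow> real) \<Rightarrow> real" where "f = (\<lambda>p x. edge_tail r u (x (fst p) + x (snd p)))"
  define F where "F = (\<lambda>y z. edge_tail r u (y + z) * (indicat_real {..t} y * indicat_real {..t} z))"
  define h :: "nat \<times> nat \<Rightarrow> (nat \<Rightarrow> real) \<Rightarrow> real" where "h = (\<lambda>p x. F (x (fst p)) (x (snd p)))"
  have V: "fst p \<in> {1..n}" "snd p \<in> {1..n}" "fst p \<noteq> snd p" if "p \<in> ?E" for p
    using that by (auto simp: pairs_def)
  have fin: "finite ?E" by (rule finite_pairs)
  have \<eta>: "0 < \<eta>" "\<eta> < 1" using u by (auto simp: \<eta>_def)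
  have F0: "0 \<le> F y z" "F y z \<le> edge_tail r u (y + z)" "F y z \<le> 1" for y z
    using edge_tail_bounds by (auto simp: F_def indicator_def)
  have F\<eta>: "F y z \<le> \<eta>" for y z
  proof (cases "y \<le> t \<and> z \<le> t")
    case True
    \<comment> \<open>\<open>Y\<close> is the gap between the level and the largest conditional mean
      under truncation. It is the optimal Chernoff parameter for variance 1; estimating
      \<open>1 - 2 * r\<close> by 1 keeps the bound valid at \<open>r = 1/2\<close>.\<close>
    define Y where "Y = u - 2 * sqrt r * t"
    have Y: "Y > 0" using u by (simp add: Y_def)
    have "F y z \<le> exp (- Y * (u - sqrt r * (y + z)) + Y\<^sup>2 * (1 - 2 * r) / 2)"
      using edge_tail_chernoff[of Y r u "y + z"] F0(2)[of y z] Y r by simp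
    also have "\<dots> \<le> \<eta>"
    proof -
      have "sqrt r * (y + z) \<le> sqrt r * (2 * t)" using True r by (intro mult_left_mono) auto
      hence "Y * Y \<le> Y * (u - sqrt r * (y + z))" using Y by (intro mult_left_mono) (auto simp: Y_def algebra_simps)
      moreover have "Y\<^sup>2 * (1 - 2 * r) \<le> Y\<^sup>2 * 1" using r by (intro mult_left_mono) auto
      ultimately show ?thesis unfolding \<eta>_def Y_def[symmetric] by (simp add: power2_eq_square)
    qed
    finally show ?thesis .
  qed (use \<eta> in \<open>auto simp: F_def\<close>)
  have F_meas: "(\<lambda>(y, z). F y z) \<in> borel_measurable (borel \<Otimes>\<^sub>M borel)"
    unfolding F_def by measurable
  have fm: "f p \<in> borel_measurable ?P" if "p \<in> ?E" for p
    unfolding f_def using V[OF that] by (intro measurable_edge_tail_sum)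
  have hm: "h p \<in> borel_measurable ?P" if "p \<in> ?E" for p
    unfolding h_def F_def using V[OF that]
    by (intro borel_measurable_times measurable_edge_tail_sum measurable_indicator_coordinate)
  have f01: "0 \<le> f p x" "f p x \<le> 1" for p x using edge_tail_bounds by (auto simp: f_def)
  have h01: "0 \<le> h p x" "h p x \<le> 1" "h p x \<le> \<eta>" "h p x \<le> f p x" for p x
    using F0 F\<eta> by (auto simp: h_def f_def)
  have intf: "integrable ?P (f p)" if "p \<in> ?E" for p
    using f01 fm[OF that] by (intro P.integrable_const_bound[where B=1]) auto
  have inth: "integrable ?P (h p)" if "p \<in> ?E" for p
    using h01 hm[OF that] by (intro P.integrable_const_bound[where B=1]) auto
  have inthh: "integrable ?P (\<lambda>x. h p x * h q x)" if "p \<in> ?E" "q \<in> ?E" for p q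
    by (intro P.integrable_const_bound[where B=1] borel_measurable_times hm that AE_I2)
       (simp add: abs_mult h01 mult_le_one)
  have Ef: "P.expectation (f p) = \<phi>" if "p \<in> ?E" for p
    unfolding f_def \<phi>_def by (rule integral_edge_tail[OF that r])
  have Eh_le: "P.expectation (h p) \<le> \<phi>" if "p \<in> ?E" for p
    unfolding Ef[OF that, symmetric] using that by (intro integral_mono inth intf h01)
  have Eh0: "0 \<le> P.expectation (h p)" for p using h01 by simp
  have Eh_ge: "\<phi> - 2 * \<delta> \<le> P.expectation (h p)" if "p \<in> ?E" for p
  proof -
    let ?g = "\<lambda>i x. f p x * indicat_real {t<..} (x i)"
    have intg: "integrable ?P (?g i)" if "i \<in> {1..n}" for i
      using f01 fm[OF \<open>p \<in> ?E\<close>] measurable_indicator_coordinate(2)[OF that]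
      by (intro P.integrable_const_bound[where B=1]) (auto simp: indicator_def)
    have g1: "P.expectation (?g (fst p)) \<le> \<delta>"
      unfolding f_def \<delta>_def using V[OF that] r u by (intro edge_tail_excess_le)
    have g2: "P.expectation (?g (snd p)) \<le> \<delta>"
      unfolding f_def \<delta>_def add.commute[of "_ (fst p)"]
      using V[OF that] r u by (intro edge_tail_excess_le) auto
    \<comment> \<open>Pointwise, \<open>f p\<close> differs from \<open>h p\<close> only if one of
      the two endpoints exceeds \<open>t\<close>.\<close>
    have "P.expectation (f p) \<le> P.expectation (\<lambda>x. h p x + (?g (fst p) x + ?g (snd p) x))"
      using f01[of p] V[OF that]
      by (intro integral_mono Bochner_Integration.integrable_add intf inth intg that)
         (auto simp: h_def F_def f_def indicator_def)
    also have "\<dots> = P.expectation (h p) + (P.expectation (?g (fst p)) + P.expectation (?g (snd p)))"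
      using inth[OF that] intg V[OF that] by simp
    finally show ?thesis using g1 g2 Ef[OF that] by simp
  qed
  define m where "m = P.expectation (\<lambda>x. \<Sum>p\<in>?E. h p x)"
  have m: "m = (\<Sum>p\<in>?E. P.expectation (h p))"
    unfolding m_def using inth by (intro Bochner_Integration.integral_sum)
  have "m \<le> N * \<phi>" unfolding m N_def using sum_bounded_above[of ?E _ \<phi>] Eh_le by auto
  moreover have "N * (\<phi> - 2 * \<delta>) \<le> m" unfolding m N_def using sum_bounded_below[of ?E "\<phi> - 2 * \<delta>"] Eh_ge by auto
  ultimately have ml: "\<bar>m - l\<bar> \<le> \<bar>N * \<phi> - l\<bar> + 2 * N * \<delta>" by (auto simp: algebra_simps)

  define share where "share p q \<longleftrightarrow> {fst p, snd p} \<inter> {fst q, snd q} \<noteq> {}" for p q :: "nat \<times> nat"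
  have Ehh: "P.expectation (\<lambda>x. h p x * h q x) \<le> P.expectation (h p) * P.expectation (h q) +
      ((if q = p then \<phi> * \<eta> else 0) + (if share p q then \<kappa> else 0))"
    if p: "p \<in> ?E" and q: "q \<in> ?E" for p q
  proof -
    have \<kappa>: "\<kappa> \<ge> 0" by (simp add: \<kappa>_def)
    have EE: "0 \<le> P.expectation (h p) * P.expectation (h q)" using Eh0 by simp
    \<comment> \<open>Disjoint edges are independent. For equal edges,
      \<open>h p \<le> \<eta>\<close> bounds the square by \<open>\<eta>\<close> times the mean.
      Distinct edges with a common vertex are handled by \<open>\<kappa>\<close>.\<close>
    consider "\<not> share p q" | "p = q" | "share p q" "p \<noteq> q" by blast
    thus ?thesis
    proof cases
      case 1
      hence "p \<noteq> q" by (auto simp: share_def)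
      moreover have "P.expectation (\<lambda>x. h p x * h q x) = P.expectation (h p) * P.expectation (h q)"
        unfolding h_def using V[OF p] V[OF q] 1 F0 F_meas
        by (intro integral_mult_disjoint_coordinates[where B=1]) (auto simp: share_def)
      ultimately show ?thesis using 1 by simp
    next
      case 2
      have "P.expectation (\<lambda>x. h p x * h q x) \<le> P.expectation (\<lambda>x. h p x * \<eta>)"
        using h01 by (intro integral_mono inthh p q integrable_mult_left inth mult_left_mono)
      also have "\<dots> = P.expectation (h p) * \<eta>" by simp
      also have "\<dots> \<le> \<phi> * \<eta>" using Eh_le[OF p] \<eta> by (intro mult_right_mono) auto
      also have "\<dots> \<le> (if q = p then \<phi> * \<eta> else 0) + (if share p q then \<kappa> else 0)"
        using 2 \<kappa> by simp
      finally show ?thesis using EE by linarith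
    next
      case 3
      obtain i j k where ijk: "i \<in> {1..n}" "j \<in> {1..n}" "k \<in> {1..n}" "i \<noteq> j" "i \<noteq> k" "j \<noteq> k"
        and pq: "p = (i, j) \<or> p = (j, i)" "q = (i, k) \<or> q = (k, i)"
      proof -
        obtain a b c d where abcd: "p = (a, b)" "q = (c, d)" by (cases p, cases q)
        have lt: "a < b" "c < d" and V': "a \<in> {1..n}" "b \<in> {1..n}" "c \<in> {1..n}" "d \<in> {1..n}"
          using V[OF p] V[OF q] p q abcd by (auto simp: pairs_def)
        have ne: "a \<noteq> c \<or> b \<noteq> d" using 3(2) abcd by simp
        have "a = c \<or> a = d \<or> b = c \<or> b = d" using 3(1) abcd by (auto simp: share_def)
        then consider "a = c" | "a = d" | "b = c" | "b = d" by blast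
        thus ?thesis
        proof cases
          case 1
          thus ?thesis using that[of a b d] abcd lt V' ne by simp
        next
          case 2
          thus ?thesis using that[of a b c] abcd lt V' by simp
        next
          case 3
          thus ?thesis using that[of b a d] abcd lt V' by simp
        next
          case 4
          thus ?thesis using that[of b a c] abcd lt V' ne by simp
        qed
      qed
      \<comment> \<open>Only the truncation of the common vertex \<open>i\<close> is kept; those of
        \<open>j\<close> and \<open>k\<close> are dropped.\<close>
      have "P.expectation (\<lambda>x. h p x * h q x) \<le>
          P.expectation (\<lambda>x. edge_tail r u (x i + x j) * edge_tail r u (x i + x k) * indicat_real {..t} (x i))"
      proof (rule integral_mono)
        show "integrable ?P (\<lambda>x. edge_tail r u (x i + x j) * edge_tail r u (x i + x k) * indicat_real {..t} (x i))"
        proof (rule P.integrable_const_bound[where B=1])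
          show "(\<lambda>x. edge_tail r u (x i + x j) * edge_tail r u (x i + x k) * indicat_real {..t} (x i)) \<in> borel_measurable ?P"
            by (intro borel_measurable_times measurable_edge_tail_sum measurable_indicator_coordinate ijk)
        qed (use edge_tail_bounds in \<open>auto simp: indicator_def abs_mult intro!: mult_le_one\<close>)
        show "h p x * h q x \<le> edge_tail r u (x i + x j) * edge_tail r u (x i + x k) * indicat_real {..t} (x i)" for x
          using pq edge_tail_bounds by (auto simp: h_def F_def indicator_def add.commute)
      qed (intro inthh p q)
      also have "\<dots> \<le> \<kappa>" unfolding \<kappa>_def pair_exponent_def by (intro edge_tail_pair_le ijk r par)
      finally show ?thesis using 3 EE by simp
    qed
  qed
  have "P.expectation (\<lambda>x. (\<Sum>p\<in>?E. h p x)\<^sup>2) = P.expectation (\<lambda>x. \<Sum>p\<in>?E. \<Sum>q\<in>?E. h p x * h q x)"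
    by (simp add: power2_eq_square sum_product)
  also have "\<dots> = (\<Sum>p\<in>?E. \<Sum>q\<in>?E. P.expectation (\<lambda>x. h p x * h q x))"
    using inthh by (simp add: Bochner_Integration.integral_sum)
  also have "\<dots> \<le> (\<Sum>p\<in>?E. \<Sum>q\<in>?E. P.expectation (h p) * P.expectation (h q) +
      ((if q = p then \<phi> * \<eta> else 0) + (if share p q then \<kappa> else 0)))"
    by (intro sum_mono Ehh)
  also have "\<dots> = m\<^sup>2 + ((\<Sum>p\<in>?E. \<phi> * \<eta>) + (\<Sum>p\<in>?E. real (card {q\<in>?E. share p q}) * \<kappa>))"
  proof -
    have "(\<Sum>q\<in>?E. if share p q then \<kappa> else 0) = real (card {q\<in>?E. share p q}) * \<kappa>" for p
      using fin by (simp flip: sum.inter_filter)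
    thus ?thesis
      using fin by (simp only: sum.distrib m power2_eq_square sum_product) simp
  qed
  also have "\<dots> \<le> m\<^sup>2 + ((\<Sum>p\<in>?E. \<phi> * \<eta>) + (\<Sum>p\<in>?E. real (2 * n) * \<kappa>))"
    by (intro add_left_mono sum_mono mult_right_mono of_nat_mono)
       (use card_incident_pairs in \<open>auto simp: share_def \<kappa>_def\<close>)
  also have "\<dots> = m\<^sup>2 + (N * \<phi> * \<eta> + N * (2 * n) * \<kappa>)" by (simp add: N_def)
  finally have second: "P.expectation (\<lambda>x. (\<Sum>p\<in>?E. h p x)\<^sup>2) \<le>
      (P.expectation (\<lambda>x. \<Sum>p\<in>?E. h p x))\<^sup>2 + (N * \<phi> * \<eta> + N * (2 * n) * \<kappa>)"
    unfolding m_def .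

  \<comment> \<open>The event that the cutoff changes nothing; a union bound over the
    \<open>n\<close> vertices controls its complement.\<close>
  define A where "A = {x\<in>space ?P. \<forall>i\<in>{1..n}. x i \<le> t}"
  have A: "A \<in> P.events" unfolding A_def
    by (intro sets.sets_Collect_finite_All sets_coordinate_le) auto
  have "P.prob (space ?P - A) \<le> P.prob (\<Union>i\<in>{1..n}. {x\<in>space ?P. t < x i})"
    by (rule P.finite_measure_mono) (auto simp: A_def not_le intro!: sets.finite_UN sets_coordinate_le)
  also have "\<dots> \<le> (\<Sum>i\<in>{1..n}. P.prob {x\<in>space ?P. t < x i})"
    by (intro P.finite_measure_subadditive_finite) (auto intro!: sets_coordinate_le)
  also have "\<dots> = (\<Sum>i\<in>{1..n}. measure std_normal_distribution {t<..})"
  proof (rule sum.cong[OF refl])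
    fix i assume i: "i \<in> {1..n}"
    have "measure std_normal_distribution {t<..} = measure (distr ?P std_normal_distribution (\<lambda>x. x i)) {t<..}"
      using distr_PiM_component[of "{1..n}" "\<lambda>_. std_normal_distribution", OF prob_space_std_normal_distribution i] by simp
    also have "\<dots> = P.prob ((\<lambda>x. x i) -` {t<..} \<inter> space ?P)"
      using i by (intro measure_distr) auto
    also have "(\<lambda>x. x i) -` {t<..} \<inter> space ?P = {x\<in>space ?P. t < x i}" by auto
    finally show "P.prob {x\<in>space ?P. t < x i} = measure std_normal_distribution {t<..}" ..
  qed
  also have "\<dots> = n * measure std_normal_distribution {t<..}" by simp
  finally have PA: "P.prob (space ?P - A) \<le> n * measure std_normal_distribution {t<..}" .

  have "\<bar>P.expectation (\<lambda>x. \<Prod>p\<in>?E. 1 - f p x) - exp (- l)\<bar> \<le> P.prob (space ?P - A) +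
      (\<bar>m - l\<bar> + sqrt (N * \<phi> * \<eta> + N * (2 * n) * \<kappa>) + l * \<eta>) / (1 - \<eta>)"
    unfolding m_def
  proof (intro P.expectation_prod_poisson_approx fin A fm hm f01 h01 \<eta> par second)
    show "f p x = h p x" if "p \<in> ?E" "x \<in> A" for p x
      using that V[OF that(1)] by (auto simp: A_def f_def h_def F_def)
  qed
  also have "P.expectation (\<lambda>x. \<Prod>p\<in>?E. 1 - f p x) = measure M {\<omega>\<in>space M. \<forall>p\<in>pairs n. G p \<omega> \<le> u}"
    unfolding f_def using prob_gaussian_field_le[OF M r order_refl] by simp
  also have "P.prob (space ?P - A) +
      (\<bar>m - l\<bar> + sqrt (N * \<phi> * \<eta> + N * (2 * n) * \<kappa>) + l * \<eta>) / (1 - \<eta>) \<le>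
      n * measure std_normal_distribution {t<..} +
      (\<bar>N * \<phi> - l\<bar> + 2 * N * \<delta> + sqrt (N * \<phi> * \<eta> + N * (2 * n) * \<kappa>) + l * \<eta>) / (1 - \<eta>)"
    using PA ml \<eta> by (intro add_mono divide_right_mono) auto
  finally show ?thesis .
qed

section \<open>Asymptotics of the error terms\<close>

lemma std_normal_density_deriv:
  "(std_normal_density has_real_derivative - (x * std_normal_density x)) (at x)"
  unfolding std_normal_density_def by (auto intro!: derivative_eq_intros simp: field_simps)

lemma std_normal_density_at_top: "(std_normal_density \<longlongrightarrow> 0) at_top"
  unfolding std_normal_density_def by real_asymp

lemma std_normal_tail_eq_nn_integral:
  "ennreal (measure std_normal_distribution {u<..}) =
     (\<integral>\<^sup>+x. ennreal (std_normal_density x) * indicator {u..} x \<partial>lborel)"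
proof -
  interpret prob_space std_normal_distribution by (rule prob_space_std_normal_distribution)
  have "ennreal (measure std_normal_distribution {u<..}) = emeasure std_normal_distribution {u<..}"
    by (rule emeasure_eq_measure[symmetric])
  also have "\<dots> = (\<integral>\<^sup>+x. ennreal (std_normal_density x) * indicator {u<..} x \<partial>lborel)"
    by (rule emeasure_density) auto
  also have "\<dots> = (\<integral>\<^sup>+x. ennreal (std_normal_density x) * indicator {u..} x \<partial>lborel)"
    by (intro nn_integral_cong_AE, rule AE_mp[OF AE_lborel_singleton[of u]]) (auto simp: indicator_def)
  finally show ?thesis .
qed

text \<open>Inserting the factor \<open>x / u\<close>, which is at least 1 on the range of
  integration, makes the integrand an exact derivative.\<close>

lemma std_normal_tail_upper:
  assumes "u > 0"
  shows "measure std_normal_distribution {u<..} \<le> std_normal_density u / u"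
proof -
  have "ennreal (measure std_normal_distribution {u<..}) \<le>
      (\<integral>\<^sup>+x. ennreal (x * std_normal_density x / u) * indicator {u..} x \<partial>lborel)"
    unfolding std_normal_tail_eq_nn_integral
  proof (intro nn_integral_mono)
    fix x :: real
    show "ennreal (std_normal_density x) * indicator {u..} x \<le>
        ennreal (x * std_normal_density x / u) * indicator {u..} x"
    proof (cases "u \<le> x")
      case True
      have "u * std_normal_density x \<le> x * std_normal_density x" using True by (intro mult_right_mono) auto
      thus ?thesis using assms by (auto simp: indicator_def field_simps intro!: ennreal_leI)
    qed auto
  qed
  also have "\<dots> = ennreal (0 - (- std_normal_density u / u))"
  proof (rule nn_integral_FTC_atLeast[where F="\<lambda>x. - std_normal_density x / u"])
    fix x assume x: "u \<le> x"
    show "((\<lambda>x. - std_normal_density x / u) has_real_derivative x * std_normal_density x / u) (at x)"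
      using assms by (auto intro!: derivative_eq_intros std_normal_density_deriv)
    show "0 \<le> x * std_normal_density x / u" using x assms by simp
  next
    have "((\<lambda>x. - std_normal_density x / u) \<longlongrightarrow> - 0 / u) at_top"
      using assms by (intro tendsto_intros std_normal_density_at_top) auto
    thus "((\<lambda>x. - std_normal_density x / u) \<longlongrightarrow> 0) at_top" by simp
  qed auto
  finally show ?thesis using assms by (simp add: ennreal_le_iff)
qed

text \<open>The derivative of \<open>- std_normal_density x / x\<close> is
  \<open>(1 + 1 / x\<^sup>2) * std_normal_density x\<close>, and the first factor is at most
  \<open>1 + 1 / u\<^sup>2\<close> beyond \<open>u\<close>.\<close>

lemma std_normal_tail_lower:
  assumes "u > 0"
  shows "std_normal_density u / u \<le> (1 + 1 / u\<^sup>2) * measure std_normal_distribution {u<..}"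
proof -
  have "ennreal (0 - (- (std_normal_density u / u))) =
      (\<integral>\<^sup>+x. ennreal ((1 + 1 / x\<^sup>2) * std_normal_density x) * indicator {u..} x \<partial>lborel)"
  proof (rule nn_integral_FTC_atLeast[where F="\<lambda>x. - (std_normal_density x / x)", symmetric])
    fix x assume x: "u \<le> x"
    show "((\<lambda>x. - (std_normal_density x / x)) has_real_derivative (1 + 1 / x\<^sup>2) * std_normal_density x) (at x)"
      using assms x
      by (auto intro!: derivative_eq_intros std_normal_density_deriv simp: field_simps power2_eq_square)
    show "0 \<le> (1 + 1 / x\<^sup>2) * std_normal_density x" by simp
  next
    have "((\<lambda>x. - (std_normal_density x * (1 / x))) \<longlongrightarrow> - (0 * 0)) at_top"
      by (intro tendsto_intros std_normal_density_at_top) real_asymp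
    thus "((\<lambda>x. - (std_normal_density x / x)) \<longlongrightarrow> 0) at_top" by simp
  qed auto
  also have "\<dots> \<le> (\<integral>\<^sup>+x. ennreal (1 + 1 / u\<^sup>2) * (ennreal (std_normal_density x) * indicator {u..} x) \<partial>lborel)"
  proof (intro nn_integral_mono)
    fix x :: real
    show "ennreal ((1 + 1 / x\<^sup>2) * std_normal_density x) * indicator {u..} x \<le>
        ennreal (1 + 1 / u\<^sup>2) * (ennreal (std_normal_density x) * indicator {u..} x)"
    proof (cases "u \<le> x")
      case True
      have "1 / x\<^sup>2 \<le> 1 / u\<^sup>2" using True assms by (intro divide_left_mono power_mono) auto
      hence "(1 + 1 / x\<^sup>2) * std_normal_density x \<le> (1 + 1 / u\<^sup>2) * std_normal_density x"
        by (intro mult_right_mono) auto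
      hence "ennreal ((1 + 1 / x\<^sup>2) * std_normal_density x) \<le> ennreal ((1 + 1 / u\<^sup>2) * std_normal_density x)"
        by (rule ennreal_leI)
      also have "\<dots> = ennreal (1 + 1 / u\<^sup>2) * ennreal (std_normal_density x)"
        by (rule ennreal_mult') simp
      finally have *: "ennreal ((1 + 1 / x\<^sup>2) * std_normal_density x) \<le>
          ennreal (1 + 1 / u\<^sup>2) * ennreal (std_normal_density x)" .
      have i: "indicator {u..} x = (1 :: ennreal)" using True by simp
      show ?thesis unfolding i mult_1_right by (rule *)
    qed auto
  qed
  also have "\<dots> = ennreal (1 + 1 / u\<^sup>2) * ennreal (measure std_normal_distribution {u<..})"
    unfolding std_normal_tail_eq_nn_integral by (rule nn_integral_cmult) auto
  also have "\<dots> = ennreal ((1 + 1 / u\<^sup>2) * measure std_normal_distribution {u<..})"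
    by (rule ennreal_mult'[symmetric]) simp
  finally show ?thesis by (simp add: ennreal_le_iff)
qed

text \<open>The threshold for the unnormalised maximum, obtained by solving for it in the inequality
  that the normalised maximum is at most \<open>x\<close>.\<close>

definition max_level :: "real \<Rightarrow> nat \<Rightarrow> real" where
  "max_level x n = (let c = sqrt (2 * ln (real n)) in sqrt 2 * c - (ln (4 * sqrt pi * c) - x) / (sqrt 2 * c))"

text \<open>This is where the centering comes from. With the level written as
  \<open>sqrt 2 * c n - \<epsilon> n\<close>, the Gaussian exponent yields
  \<open>exp (- (c n)\<^sup>2)\<close>, which is \<open>1 / n\<^sup>2\<close>, and
  \<open>exp (sqrt 2 * c n * \<epsilon> n)\<close>, which is
  \<open>4 * sqrt pi * c n * exp (- x)\<close>. The constant \<open>4 * sqrt pi\<close> equals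
  \<open>2 * sqrt 2 * sqrt (2 * pi)\<close>: 2 for the number of pairs, \<open>sqrt 2\<close> (with
  \<open>c n\<close>) for the division by the level, and \<open>sqrt (2 * pi)\<close> for the
  density.\<close>

lemma expected_exceedances_density_tendsto:
  "(\<lambda>n. real n * (real n - 1) / 2 * (std_normal_density (max_level x n) / max_level x n)) \<longlonglongrightarrow> exp (- x)"
proof -
  define c where "c n = sqrt (2 * ln (real n))" for n :: nat
  define \<epsilon> where "\<epsilon> n = (ln (4 * sqrt pi * c n) - x) / (sqrt 2 * c n)" for n
  have "\<epsilon> \<longlonglongrightarrow> 0" "(\<lambda>n. \<epsilon> n / (sqrt 2 * c n)) \<longlonglongrightarrow> 0" "(\<lambda>n. 1 / real n) \<longlonglongrightarrow> 0"
    unfolding \<epsilon>_def c_def by real_asymp+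
  hence "(\<lambda>n. (1 - 1 / real n) * (1 / (1 - \<epsilon> n / (sqrt 2 * c n))) * exp (- (\<epsilon> n)\<^sup>2 / 2) * exp (- x)) \<longlonglongrightarrow>
      (1 - 0) * (1 / (1 - 0)) * exp (- 0\<^sup>2 / 2) * exp (- x)"
    by (intro tendsto_intros) auto
  moreover have "eventually (\<lambda>n. real n * (real n - 1) / 2 * (std_normal_density (max_level x n) / max_level x n) =
      (1 - 1 / real n) * (1 / (1 - \<epsilon> n / (sqrt 2 * c n))) * exp (- (\<epsilon> n)\<^sup>2 / 2) * exp (- x)) sequentially"
    using eventually_gt_at_top[of 1]
  proof eventually_elim
    case (elim n)
    have c: "c n > 0" using elim by (simp add: c_def)
    have "(c n)\<^sup>2 = 2 * ln (real n)" using elim by (simp add: c_def)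
    hence n: "exp (- (c n)\<^sup>2) = 1 / (real n)\<^sup>2"
      using elim by (simp add: exp_minus exp_double field_simps)
    have lvl: "max_level x n = sqrt 2 * c n - \<epsilon> n"
      by (simp add: max_level_def Let_def c_def \<epsilon>_def)
    have "- (sqrt 2 * c n - \<epsilon> n)\<^sup>2 / 2 = - (c n)\<^sup>2 + sqrt 2 * c n * \<epsilon> n - (\<epsilon> n)\<^sup>2 / 2"
      by (simp add: power2_diff power_mult_distrib field_simps)
    also have "sqrt 2 * c n * \<epsilon> n = ln (4 * sqrt pi * c n) - x"
      using c by (simp add: \<epsilon>_def)
    finally have "- (sqrt 2 * c n - \<epsilon> n)\<^sup>2 / 2 =
        - (c n)\<^sup>2 + ln (4 * sqrt pi * c n) + - x + - (\<epsilon> n)\<^sup>2 / 2" by simp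
    moreover have "exp (ln (4 * sqrt pi * c n)) = 4 * sqrt pi * c n" using c by simp
    ultimately have e: "exp (- (sqrt 2 * c n - \<epsilon> n)\<^sup>2 / 2) =
        1 / (real n)\<^sup>2 * (4 * sqrt pi * c n) * exp (- x) * exp (- (\<epsilon> n)\<^sup>2 / 2)"
      using n by (simp only: exp_add)
    have "4 * sqrt pi / (2 * sqrt (2 * pi)) = sqrt 2"
      by (simp add: real_sqrt_mult field_simps)
    hence k: "4 * sqrt pi = 2 * sqrt 2 * sqrt (2 * pi)" by (simp add: field_simps)
    have "1 - \<epsilon> n / (sqrt 2 * c n) = (sqrt 2 * c n - \<epsilon> n) / (sqrt 2 * c n)" using c by (simp add: diff_divide_distrib)
    hence 1: "1 / (1 - \<epsilon> n / (sqrt 2 * c n)) = sqrt 2 * c n / (sqrt 2 * c n - \<epsilon> n)" by simp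
    have 2: "1 - 1 / real n = real n * (real n - 1) / 2 * (1 / (real n)\<^sup>2) * 2"
      using elim by (simp add: field_simps power2_eq_square)
    have 3: "a * (1 / q * (b * (2 * s * q * d) * X * Y) / w) = a * b * 2 * (s * d / w) * Y * X"
      if "q \<noteq> 0" for a b q s d X Y w :: real using that by simp
    show ?case
      unfolding lvl std_normal_density_def e k 1 2 by (rule 3) simp
  qed
  ultimately show ?thesis by (simp add: filterlim_cong)
qed

lemma max_level_asymp:
  "(\<lambda>n. 1 + 1 / (max_level x n)\<^sup>2) \<longlonglongrightarrow> 1" "eventually (\<lambda>n. max_level x n > 0) sequentially"
  unfolding max_level_def Let_def by real_asymp+

text \<open>At the cutoff \<open>exp (- c\<^sup>2 / 2)\<close> is exactly \<open>1 / n\<close>, so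
  the bound on the expected number of vertices above it is \<open>1 / (sqrt (2 * pi) * c)\<close>.
  The division by \<open>c\<close> in the tail bound is what makes it vanish.\<close>

lemma vertex_density_tendsto:
  "(\<lambda>n. real n * (std_normal_density (sqrt (2 * ln (real n))) / sqrt (2 * ln (real n)))) \<longlonglongrightarrow> 0"
proof -
  have "(\<lambda>n. 1 / sqrt (2 * pi) * (1 / sqrt (2 * ln (real n)))) \<longlonglongrightarrow> 1 / sqrt (2 * pi) * 0"
    by (intro tendsto_mult tendsto_const) real_asymp
  moreover have "eventually (\<lambda>n. real n * (std_normal_density (sqrt (2 * ln (real n))) / sqrt (2 * ln (real n))) =
      1 / sqrt (2 * pi) * (1 / sqrt (2 * ln (real n)))) sequentially"
    using eventually_gt_at_top[of 1]
    by eventually_elim (simp add: std_normal_density_def exp_minus)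
  ultimately show ?thesis by (simp add: filterlim_cong)
qed

text \<open>\<open>c n * \<epsilon> n\<close> is
  \<open>(ln (4 * sqrt pi * c n) - x) / sqrt 2\<close>, and \<open>ln (c n)\<close> grows like half
  of \<open>ln (ln n)\<close>. The constants 20 and 34 are those consumed by the exponent estimates
  below.\<close>

lemma max_level_correction_asymp:
  fixes x :: real and c \<epsilon> :: "nat \<Rightarrow> real"
  defines "c \<equiv> (\<lambda>n. sqrt (2 * ln (real n)))"
  defines "\<epsilon> \<equiv> (\<lambda>n. (ln (4 * sqrt pi * c n) - x) / (sqrt 2 * c n))"
  shows "eventually (\<lambda>n. 0 \<le> \<epsilon> n \<and> \<epsilon> n \<le> 1 \<and> c n * \<epsilon> n \<le> ln (ln (real n)) \<and>
    1 \<le> ln (ln (real n)) \<and> 20 \<le> c n \<and> 34 * ln (ln (real n)) \<le> (c n)\<^sup>2) sequentially"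
proof -
  have "eventually (\<lambda>n. \<epsilon> n \<ge> 0) sequentially" "eventually (\<lambda>n. \<epsilon> n \<le> 1) sequentially"
    "eventually (\<lambda>n. ln (4 * sqrt pi * c n) - x \<le> ln (ln (real n))) sequentially"
    "eventually (\<lambda>n. 1 \<le> ln (ln (real n))) sequentially"
    "eventually (\<lambda>n. c n \<ge> 20) sequentially"
    "eventually (\<lambda>n. 34 * ln (ln (real n)) \<le> 2 * ln (real n)) sequentially"
    unfolding c_def \<epsilon>_def by real_asymp+
  thus ?thesis using eventually_gt_at_top[of 1]
  proof eventually_elim
    case (elim n)
    have "1 * (c n * \<epsilon> n) \<le> sqrt 2 * (c n * \<epsilon> n)" using elim by (intro mult_right_mono) auto
    also have "sqrt 2 * (c n * \<epsilon> n) = ln (4 * sqrt pi * c n) - x" using elim by (simp add: \<epsilon>_def)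
    finally have "c n * \<epsilon> n \<le> ln (ln (real n))" using elim by simp
    moreover have "(c n)\<^sup>2 = 2 * ln (real n)" using elim by (simp add: c_def)
    ultimately show ?case using elim by simp
  qed
qed

text \<open>Here \<open>L\<close> stands for \<open>ln (ln n)\<close>. The last three claims compare
  \<open>\<eta>\<close>, \<open>\<delta>\<close> and \<open>\<kappa>\<close> with 1 and with the
  powers of \<open>n\<close> of order -2 and -3, written as \<open>exp (- c\<^sup>2)\<close> and
  \<open>exp (- 3 * c\<^sup>2 / 2)\<close>; each comparison leaves a spare factor
  \<open>exp (- L)\<close>. The correction \<open>\<epsilon>\<close> loses at most a multiple of
  \<open>L\<close>, which \<open>T\<^sup>2 \<ge> 16 * L\<close> outweighs.\<close>

lemma truncation_parameters:
  fixes r c \<epsilon> L u :: real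
  defines "u \<equiv> sqrt 2 * c - \<epsilon>"
  assumes r: "0 \<le> r" "r \<le> 1/2" and \<epsilon>: "0 \<le> \<epsilon>" "\<epsilon> \<le> 1" "c * \<epsilon> \<le> L" and L: "1 \<le> L"
    and c: "20 \<le> c" "34 * L \<le> c\<^sup>2" and T: "4 * L \<le> (1 - sqrt (2 * r)) * c"
  shows "0 \<le> u" "sqrt r * u \<le> c" "2 * sqrt r * c < u"
    and "exp (- (u - 2 * sqrt r * c)\<^sup>2 / 2) \<le> exp (- L)"
    and "- u\<^sup>2 / 2 - (c - sqrt r * u)\<^sup>2 / 2 \<le> - c\<^sup>2 - L"
    and "\<exists>\<theta>\<ge>0. \<exists>\<beta>\<ge>0. pair_exponent r u c \<theta> \<beta> \<le> - 3 * c\<^sup>2 / 2 - L"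
proof -
  define T where "T = (1 - sqrt (2 * r)) * c"
  have T4: "4 * L \<le> T" using T by (simp add: T_def)
  have s2: "1 \<le> sqrt 2" "sqrt 2 \<le> 1.5" "1.414 \<le> sqrt 2"
    by (rule real_le_rsqrt real_le_lsqrt; simp add: power2_eq_square)+
  have s2s: "(sqrt 2)\<^sup>2 = 2" by simp
  have sr: "0 \<le> sqrt r" "(sqrt r)\<^sup>2 = r" using r by auto
  have s2r: "sqrt (2 * r) = sqrt 2 * sqrt r" by (rule real_sqrt_mult)
  have "sqrt (2 * r) \<le> 1" using r by simp
  hence srle: "sqrt 2 * sqrt r \<le> 1" by (simp add: s2r)
  have sr1: "sqrt r \<le> 1" using mult_right_mono[OF s2(1) sr(1)] srle by linarith
  have "1 * c \<le> sqrt 2 * c" using s2 c by (intro mult_right_mono) auto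
  thus u0: "0 \<le> u" using \<epsilon> c unfolding u_def by linarith
  have re: "0 \<le> sqrt r * \<epsilon>" "sqrt r * \<epsilon> \<le> 1" using sr sr1 \<epsilon> by (auto intro!: mult_le_one)
  have cu: "c - sqrt r * u = T + sqrt r * \<epsilon>"
    unfolding u_def T_def s2r by (simp add: algebra_simps)
  show "sqrt r * u \<le> c" using cu re T4 L by linarith
  have uc: "u - 2 * sqrt r * c = sqrt 2 * T - \<epsilon>"
  proof -
    have "sqrt 2 * T = sqrt 2 * c - (sqrt 2)\<^sup>2 * sqrt r * c"
      unfolding T_def s2r by (simp add: algebra_simps power2_eq_square del: real_sqrt_pow2_iff real_sqrt_pow2 real_sqrt_mult_self)
    thus ?thesis unfolding u_def s2s by simp
  qed
  have "1 * T \<le> sqrt 2 * T" using s2 T4 L by (intro mult_right_mono) auto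
  hence uc3: "3 * L \<le> u - 2 * sqrt r * c" using uc T4 \<epsilon> L by linarith
  thus "2 * sqrt r * c < u" using L by linarith
  have LL: "L \<le> L\<^sup>2" using mult_left_mono[OF L, of L] L by (simp add: power2_eq_square)
  have "9 * L\<^sup>2 = (3 * L)\<^sup>2" by (simp add: power_mult_distrib)
  also have "\<dots> \<le> (u - 2 * sqrt r * c)\<^sup>2" using uc3 L by (intro power_mono) auto
  finally have "- (u - 2 * sqrt r * c)\<^sup>2 / 2 \<le> - L" using LL L by linarith
  thus "exp (- (u - 2 * sqrt r * c)\<^sup>2 / 2) \<le> exp (- L)" by simp
  have ce: "0 \<le> c * \<epsilon>" using c \<epsilon> by simp
  have sce: "sqrt 2 * (c * \<epsilon>) \<le> 1.5 * L"
    using mult_mono[OF s2(2) \<epsilon>(3)] ce by simp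
  have u2: "u\<^sup>2 = 2 * c\<^sup>2 - 2 * (sqrt 2 * (c * \<epsilon>)) + \<epsilon>\<^sup>2"
    by (simp add: u_def power2_diff power_mult_distrib)
  have \<epsilon>2: "0 \<le> \<epsilon>\<^sup>2" by simp
  have TT: "16 * L \<le> T\<^sup>2"
  proof -
    have "16 * L\<^sup>2 = (4 * L)\<^sup>2" by (simp add: power_mult_distrib)
    also have "\<dots> \<le> T\<^sup>2" using T4 L by (intro power_mono) auto
    finally show ?thesis using LL by linarith
  qed
  have "T\<^sup>2 \<le> (c - sqrt r * u)\<^sup>2" using cu re T4 L by (intro power_mono) auto
  thus "- u\<^sup>2 / 2 - (c - sqrt r * u)\<^sup>2 / 2 \<le> - c\<^sup>2 - L"
    using u2 sce TT \<epsilon>2 L by linarith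
  show "\<exists>\<theta>\<ge>0. \<exists>\<beta>\<ge>0. pair_exponent r u c \<theta> \<beta> \<le> - 3 * c\<^sup>2 / 2 - L"
  \<comment> \<open>Any threshold strictly between \<open>(sqrt 2 - 1)\<^sup>2\<close>, about 0.172,
    and 1/3 separates the regimes: below 1/3 the untruncated bound leaves room in the power of
    \<open>n\<close>, and above the lower value the optimal \<open>\<beta>\<close> is nonnegative to
    leading order.\<close>
  proof (cases "r \<le> 1/4")
    case True
    \<comment> \<open>No truncation: with \<open>\<beta> = 0\<close> the exponent is quadratic in
      \<open>\<theta>\<close> with minimiser \<open>u / (1 + r)\<close>.\<close>
    have "pair_exponent r u c (u / (1 + r)) 0 = - (u\<^sup>2 / (1 + r))"
    proof -
      have "pair_exponent r u c \<theta> 0 = - 2 * \<theta> * u + \<theta>\<^sup>2 * (1 + r)" for \<theta>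
        using sr by (simp add: pair_exponent_def power_mult_distrib algebra_simps)
      hence *: "pair_exponent r u c (u / (1 + r)) 0 = - 2 * (u / (1 + r)) * u + (u / (1 + r))\<^sup>2 * (1 + r)" .
      have "- 2 * (u / k) * u + (u / k)\<^sup>2 * k = - (u\<^sup>2 / k)" if "k > 0" for k
        using that by (simp add: power2_eq_square)
      hence "- 2 * (u / (1 + r)) * u + (u / (1 + r))\<^sup>2 * (1 + r) = - (u\<^sup>2 / (1 + r))" using r by simp
      with * show ?thesis by (rule trans)
    qed
    also have "\<dots> \<le> - (u\<^sup>2 / (5/4))"
      using r True by (intro le_imp_neg_le divide_left_mono) auto
    also have "- (u\<^sup>2 / (5/4)) = - (4/5 * u\<^sup>2)" by simp
    \<comment> \<open>To leading order \<open>4/5 * u\<^sup>2\<close> is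
      \<open>8/5 * c\<^sup>2\<close>; the surplus \<open>c\<^sup>2 / 10\<close> has to pay for
      \<open>2.4 * L\<close> from \<open>\<epsilon>\<close> and for \<open>L\<close> itself, hence
      \<open>34 * L \<le> c\<^sup>2\<close>.\<close>
    also have "\<dots> \<le> - 3 * c\<^sup>2 / 2 - L" using u2 sce c \<epsilon>2 by linarith
    finally show ?thesis using u0 r by (intro exI[of _ "u / (1 + r)"] exI[of _ 0]) auto
  next
    case False
    \<comment> \<open>Joint minimiser of the exponent: stationarity in \<open>\<beta>\<close> gives
      \<open>2 * \<theta> * sqrt r - \<beta> = c\<close>, so the tilted mean of the common vertex
      sits at the cutoff. The remaining quadratic in \<open>\<theta>\<close> is minimal at
      \<open>w / (1 - r)\<close>.\<close>
    define w where "w = u - sqrt r * c"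
    define \<theta> where "\<theta> = w / (1 - r)"
    define \<beta> where "\<beta> = 2 * \<theta> * sqrt r - c"
    have sr2: "1/2 \<le> sqrt r" using False by (intro real_le_rsqrt) (auto simp: power2_eq_square)
    have w0: "0 \<le> w"
    proof -
      have "sqrt r * c \<ge> 0" using sr c by simp
      thus ?thesis using uc3 L unfolding w_def by linarith
    qed
    hence \<theta>0: "0 \<le> \<theta>" using r by (simp add: \<theta>_def)
    have \<theta>w: "\<theta> * (1 - r) = w" using r by (simp add: \<theta>_def)
    text \<open>This is the point where \<^term>\<open>r > 1/4\<close> is needed: it makes the tilt \<^term>\<open>\<beta>\<close> nonnegative.\<close>
    have \<beta>0: "0 \<le> \<beta>"
    proof -
      have "(1 - r) * c \<le> 2 * w * sqrt r"
      proof -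
        have "2 * w * sqrt r = 2 * (sqrt 2 * sqrt r) * c - 2 * (sqrt r * \<epsilon>) - 2 * r * c"
          using sr(2) by (simp add: w_def u_def algebra_simps power2_eq_square)
        \<comment> \<open>The margin \<open>c / 10\<close> absorbs
          \<open>2 * (sqrt r * \<epsilon>) \<le> 2\<close>, which is why \<open>c\<close> is at
          least 20.\<close>
        moreover have "(1 + r + 1/10) * c \<le> 2 * (sqrt 2 * sqrt r) * c"
        proof (rule mult_right_mono)
          \<comment> \<open>For \<open>sqrt r\<close> between 1/2 and 3/4 this replaces
            \<open>r\<close> by its chord, linear in \<open>sqrt r\<close>, so that the claim
            becomes linear arithmetic.\<close>
          have "0 \<le> (sqrt r - 1/2) * (3/4 - sqrt r)"
          proof (rule mult_nonneg_nonneg)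
            have "sqrt r \<le> 1 / 1.414"
              using mult_right_mono[OF s2(3) sr(1)] srle by (simp add: field_simps)
            thus "0 \<le> 3/4 - sqrt r" by (simp add: field_simps)
          qed (use sr2 in simp)
          also have "(y - 1/2) * (3/4 - y) = 5/4 * y - 3/8 - y\<^sup>2" for y :: real
            by (simp add: field_simps power2_eq_square)
          finally have "r \<le> 5/4 * sqrt r - 3/8" unfolding sr(2) by simp
          moreover have "1.414 * sqrt r \<le> sqrt 2 * sqrt r" using s2(3) sr by (intro mult_right_mono) auto
          ultimately show "1 + r + 1/10 \<le> 2 * (sqrt 2 * sqrt r)" using sr2 by simp
        qed (use c in simp)
        ultimately show ?thesis using re c by (simp add: algebra_simps)
      qed
      hence "c \<le> 2 * w * sqrt r / (1 - r)" using r by (simp add: field_simps)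
      thus ?thesis by (simp add: \<beta>_def \<theta>_def)
    qed
    have "pair_exponent r u c \<theta> \<beta> = - 2 * \<theta> * u + \<theta> * (\<theta> * (1 - r)) + 2 * \<theta> * sqrt r * c - c\<^sup>2 / 2"
      by (simp add: pair_exponent_def \<beta>_def power2_eq_square algebra_simps)
    also have "\<dots> = - (\<theta> * w) - c\<^sup>2 / 2"
      unfolding \<theta>w by (simp add: w_def algebra_simps)
    finally have pe: "pair_exponent r u c \<theta> \<beta> = - (w\<^sup>2 / (1 - r)) - c\<^sup>2 / 2"
      by (simp add: \<theta>_def power2_eq_square)
    \<comment> \<open>The identity \<open>(sqrt 2 - sqrt r)\<^sup>2 = (1 - r) + (1 - sqrt (2 *
      r))\<^sup>2\<close> isolates the main term. After division by \<open>1 - r\<close> it gives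
      \<open>c\<^sup>2\<close>, which with \<open>c\<^sup>2 / 2\<close> matches \<open>n ^ 3\<close>
      exactly and leaves \<open>T\<^sup>2\<close> as the gain.\<close>
    have w2: "w\<^sup>2 = (1 - r) * c\<^sup>2 + T\<^sup>2 - 2 * ((sqrt 2 - sqrt r) * (c * \<epsilon>)) + \<epsilon>\<^sup>2"
    proof -
      have "w\<^sup>2 = (sqrt 2 - sqrt r)\<^sup>2 * c\<^sup>2 - 2 * ((sqrt 2 - sqrt r) * (c * \<epsilon>)) + \<epsilon>\<^sup>2"
        by (simp add: w_def u_def power2_eq_square algebra_simps)
      moreover have "(sqrt 2 - sqrt r)\<^sup>2 = (1 - r) + (1 - sqrt (2 * r))\<^sup>2"
        using sr s2s r by (simp add: s2r power2_diff power_mult_distrib)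
      moreover have "T\<^sup>2 = (1 - sqrt (2 * r))\<^sup>2 * c\<^sup>2" unfolding T_def by (rule power_mult_distrib)
      ultimately show ?thesis by (simp only: distrib_right)
    qed
    have "(sqrt 2 - sqrt r) * (c * \<epsilon>) \<le> sqrt 2 * (c * \<epsilon>)"
      using sr ce by (intro mult_right_mono) auto
    hence "(1 - r) * c\<^sup>2 + L \<le> w\<^sup>2" using w2 sce TT \<epsilon>2 L by linarith
    hence "((1 - r) * c\<^sup>2 + L) / (1 - r) \<le> w\<^sup>2 / (1 - r)" using r by (intro divide_right_mono) auto
    moreover have "((1 - r) * c\<^sup>2 + L) / (1 - r) = c\<^sup>2 + L / (1 - r)" using r by (simp add: add_divide_distrib)
    moreover have "L / 1 \<le> L / (1 - r)" using r L by (intro divide_left_mono) auto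
    ultimately have "pair_exponent r u c \<theta> \<beta> \<le> - 3 * c\<^sup>2 / 2 - L" unfolding pe by (simp add: field_simps)
    thus ?thesis using \<theta>0 \<beta>0 by blast
  qed
qed

section \<open>The limit theorem\<close>

lemma cdf_gumbel_measure: "cdf gumbel_measure x = exp (- exp (- x))"
proof -
  have "emeasure gumbel_measure {..x} = (\<integral>\<^sup>+y. ennreal (exp (- y - exp (- y))) * indicator {..x} y \<partial>lborel)"
    unfolding gumbel_measure_def by (rule emeasure_density) auto
  \<comment> \<open>Reflection moves the infinite end to plus infinity, where the antiderivative
    \<open>- exp (- exp y)\<close> vanishes.\<close>
  also have "\<dots> = (\<integral>\<^sup>+y. ennreal (exp (y - exp y)) * indicator {- x..} y \<partial>lborel)"
    by (subst nn_integral_real_affine[of _ "-1" 0])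
       (auto simp: indicator_def intro!: nn_integral_cong)
  also have "\<dots> = ennreal (0 - (- exp (- exp (- x))))"
  proof (rule nn_integral_FTC_atLeast[where F="\<lambda>y. - exp (- exp y)"])
    show "((\<lambda>y. - exp (- exp y)) has_real_derivative exp (y - exp y)) (at y)" for y :: real
      by (auto intro!: derivative_eq_intros simp: exp_diff exp_minus field_simps)
    show "((\<lambda>y :: real. - exp (- exp y)) \<longlongrightarrow> 0) at_top" by real_asymp
  qed auto
  finally show ?thesis by (simp add: cdf_def measure_def)
qed

lemma cdf_normalized_max:
  assumes "prob_space M" and n: "n \<ge> 2" and G: "\<And>p. p \<in> pairs n \<Longrightarrow> G p \<in> borel_measurable M"
  shows "cdf (distr M borel (\<lambda>\<omega>. let c = sqrt (2 * ln (real n)) in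
            sqrt 2 * c * (Max ((\<lambda>p. G p \<omega>) ` pairs n) - sqrt 2 * c + ln (4 * sqrt pi * c) / (sqrt 2 * c)))) x =
         measure M {\<omega>\<in>space M. \<forall>p\<in>pairs n. G p \<omega> \<le> max_level x n}"
proof -
  let ?c = "sqrt (2 * ln (real n))"
  let ?Z = "\<lambda>\<omega>. let c = ?c in
            sqrt 2 * c * (Max ((\<lambda>p. G p \<omega>) ` pairs n) - sqrt 2 * c + ln (4 * sqrt pi * c) / (sqrt 2 * c))"
  have [measurable]: "(\<lambda>\<omega>. Max ((\<lambda>p. G p \<omega>) ` pairs n)) \<in> borel_measurable M"
    by (intro borel_measurable_Max finite_pairs G)
  have c: "?c > 0" using n by simp
  have "(1, 2) \<in> pairs n" using n by (simp add: pairs_def)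
  hence ne: "pairs n \<noteq> {}" by blast
  have "?Z \<omega> \<le> x \<longleftrightarrow> (\<forall>p\<in>pairs n. G p \<omega> \<le> max_level x n)" for \<omega>
  proof -
    have level: "k * (m - k + a / k) \<le> x \<longleftrightarrow> m \<le> k - (a - x) / k" if "k > 0" for k m a :: real
    proof -
      have "k * (m - k + a / k) = k * m - k * k + a" "k * (k - (a - x) / k) = k * k - (a - x)"
        using that by (simp add: ring_distribs, simp add: right_diff_distrib[of k k])
      moreover have "m \<le> k - (a - x) / k \<longleftrightarrow> k * m \<le> k * (k - (a - x) / k)"
        using that by (simp only: mult_le_cancel_left_pos)
      ultimately show ?thesis by auto
    qed
    have "?Z \<omega> \<le> x \<longleftrightarrow> Max ((\<lambda>p. G p \<omega>) ` pairs n) \<le> max_level x n"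
      unfolding Let_def max_level_def using c by (intro level) simp
    also have "\<dots> \<longleftrightarrow> (\<forall>p\<in>pairs n. G p \<omega> \<le> max_level x n)"
      using finite_pairs ne by simp
    finally show ?thesis .
  qed
  hence "?Z -` {..x} \<inter> space M = {\<omega>\<in>space M. \<forall>p\<in>pairs n. G p \<omega> \<le> max_level x n}" by auto
  moreover have "?Z \<in> borel_measurable M" unfolding Let_def by measurable
  ultimately show ?thesis by (simp only: cdf_def measure_distr[OF _ atMost_borel])
qed

theorem theorem2p1:
  fixes M :: "nat \<Rightarrow> 'a measure"
    and G :: "nat \<Rightarrow> nat \<times> nat \<Rightarrow> 'a \<Rightarrow> real"
    and r :: "nat \<Rightarrow> real"
  assumes prob: "\<And>n. n \<ge> 2 \<Longrightarrow> prob_space (M n)"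
    and r_range: "\<And>n. n \<ge> 2 \<Longrightarrow> 0 \<le> r n \<and> r n \<le> 1/2"
    and field: "\<And>n. n \<ge> 2 \<Longrightarrow> centered_gaussian_field (M n) (pairs n) (G n) (edge_cov (r n))"
    and growth: "filterlim (\<lambda>n. (1 - 2 * r n) * sqrt (ln (real n)) / ln (ln (real n))) at_top sequentially"
  shows "weak_conv_m
           (\<lambda>n. distr (M n) borel
              (\<lambda>\<omega>. let c = sqrt (2 * ln (real n)) in
                 sqrt 2 * c * (Max ((\<lambda>p. G n p \<omega>) ` pairs n) - sqrt 2 * c
                   + ln (4 * sqrt pi * c) / (sqrt 2 * c))))
           gumbel_measure"
  unfolding weak_conv_m_def weak_conv_def
proof (intro allI impI)
  fix x :: real
  define Q where "Q u = measure std_normal_distribution {u<..}" for u :: real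
  define N where "N n = real (card (pairs n))" for n
  define c where "c n = sqrt (2 * ln (real n))" for n :: nat
  define \<epsilon> where "\<epsilon> n = (ln (4 * sqrt pi * c n) - x) / (sqrt 2 * c n)" for n
  define L where "L n = ln (ln (real n))" for n :: nat
  define u where "u n = max_level x n" for n
  define l where "l = exp (- x)"
  \<comment> \<open>For \<open>n \<ge> 2\<close> this is \<open>1 / ln n\<close>. It serves as a
    common bound for \<open>\<eta>\<close>, \<open>N * \<delta>\<close> and
    \<open>N * (2 * n) * \<kappa>\<close>, so the error \<open>?B\<close> no longer depends on
    \<open>\<theta>\<close> and \<open>\<beta>\<close>, which vary with \<open>n\<close>.\<close>
  define e where "e n = exp (- L n)" for n
  let ?P = "\<lambda>n. measure (M n) {\<omega>\<in>space (M n). \<forall>p\<in>pairs n. G n p \<omega> \<le> u n}"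
  let ?B = "\<lambda>n. real n * Q (c n) +
      (\<bar>N n * Q (u n) - l\<bar> + 2 * e n + sqrt (N n * Q (u n) * e n + e n) + l * e n) / (1 - e n)"
  have u_eq: "u n = sqrt 2 * c n - \<epsilon> n" for n
    by (simp add: u_def max_level_def Let_def c_def \<epsilon>_def)
  have N_eq: "N n = real n * (real n - 1) / 2" for n
  proof -
    have "2 * N n = real (n * (n - 1))"
      unfolding N_def card_pairs[symmetric] by simp
    thus ?thesis by (cases n) (auto simp: field_simps)
  qed

  have e0: "e \<longlonglongrightarrow> 0" unfolding e_def L_def by real_asymp
  have Q0: "Q z \<ge> 0" for z by (simp add: Q_def)
  have vertices: "(\<lambda>n. real n * Q (c n)) \<longlonglongrightarrow> 0"
  proof (rule tendsto_sandwich[OF _ _ tendsto_const vertex_density_tendsto])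
    show "eventually (\<lambda>n. real n * Q (c n) \<le>
        real n * (std_normal_density (sqrt (2 * ln (real n))) / sqrt (2 * ln (real n)))) sequentially"
      using eventually_gt_at_top[of 1]
    proof eventually_elim
      case (elim n)
      thus ?case unfolding Q_def c_def by (intro mult_left_mono std_normal_tail_upper) auto
    qed
  qed (use Q0 in simp)
  let ?d = "\<lambda>n. N n * (std_normal_density (u n) / u n)"
  \<comment> \<open>The expected number of edges above the level tends to \<open>exp (- x)\<close>,
    the Poisson parameter of the limit; the two tail bounds sandwich it.\<close>
  have edges: "(\<lambda>n. N n * Q (u n)) \<longlonglongrightarrow> l"
  proof (rule tendsto_sandwich[where f="\<lambda>n. ?d n / (1 + 1 / (u n)\<^sup>2)" and h="?d"])
    show d: "?d \<longlonglongrightarrow> l"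
      using expected_exceedances_density_tendsto[of x] by (simp add: N_eq l_def u_def)
    show "(\<lambda>n. ?d n / (1 + 1 / (u n)\<^sup>2)) \<longlonglongrightarrow> l"
      using tendsto_divide[OF d max_level_asymp(1)[of x]] by (simp add: u_def)
    have upos: "eventually (\<lambda>n. u n > 0) sequentially"
      using max_level_asymp(2)[of x] by (simp add: u_def)
    thus "eventually (\<lambda>n. N n * Q (u n) \<le> ?d n) sequentially"
      by eventually_elim (unfold Q_def N_def, intro mult_left_mono std_normal_tail_upper of_nat_0_le_iff)
    show "eventually (\<lambda>n. ?d n / (1 + 1 / (u n)\<^sup>2) \<le> N n * Q (u n)) sequentially"
      using upos
    proof eventually_elim
      case (elim n)
      have "1 + 1 / (u n)\<^sup>2 > 0" by (intro add_pos_nonneg) auto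
      moreover have "N n * (std_normal_density (u n) / u n) \<le> N n * ((1 + 1 / (u n)\<^sup>2) * Q (u n))"
        unfolding Q_def N_def using elim by (intro mult_left_mono std_normal_tail_lower) auto
      ultimately show ?case by (simp only: pos_divide_le_eq mult_ac)
    qed
  qed
  have "?B \<longlonglongrightarrow> 0 + (\<bar>l - l\<bar> + 2 * 0 + sqrt (l * 0 + 0) + l * 0) / (1 - 0)"
    by (intro tendsto_intros vertices edges e0) simp
  hence B: "?B \<longlonglongrightarrow> 0" by simp

  \<comment> \<open>The value 8 yields \<open>4 * L n \<le> (1 - sqrt (2 * r n)) * c n\<close>:
    factoring \<open>1 - 2 * r n\<close> loses at most \<open>1 + sqrt (2 * r n) \<le> 2\<close>,
    and \<open>sqrt (ln n) \<le> c n\<close>.\<close>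
  have growth8: "eventually (\<lambda>n. 8 \<le> (1 - 2 * r n) * sqrt (ln (real n)) / ln (ln (real n))) sequentially"
    using growth by (simp add: filterlim_at_top)
  have "eventually (\<lambda>n. \<bar>?P n - exp (- l)\<bar> \<le> ?B n) sequentially"
    using growth8 max_level_correction_asymp[of x] eventually_ge_at_top[of 2]
  proof eventually_elim
    case (elim n)
    have r: "0 \<le> r n" "r n \<le> 1/2" using r_range[of n] elim by auto
    have \<epsilon>: "0 \<le> \<epsilon> n" "\<epsilon> n \<le> 1" "c n * \<epsilon> n \<le> L n" and L: "1 \<le> L n"
      and c: "20 \<le> c n" "34 * L n \<le> (c n)\<^sup>2"
      using elim by (auto simp: \<epsilon>_def c_def L_def)
    have T: "4 * L n \<le> (1 - sqrt (2 * r n)) * c n"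
    proof -
      have s: "0 \<le> sqrt (2 * r n)" "sqrt (2 * r n) \<le> 1" "(sqrt (2 * r n))\<^sup>2 = 2 * r n" using r by auto
      have "1 - 2 * r n = (1 - sqrt (2 * r n)) * (1 + sqrt (2 * r n))"
      proof -
        have "1 - y\<^sup>2 = (1 - y) * (1 + y)" for y :: real by (simp add: algebra_simps power2_eq_square)
        from this[of "sqrt (2 * r n)"] show ?thesis by (simp only: s(3))
      qed
      also have "\<dots> \<le> (1 - sqrt (2 * r n)) * 2" using s by (intro mult_left_mono) auto
      finally have r2: "1 - 2 * r n \<le> (1 - sqrt (2 * r n)) * 2" .
      have "8 * L n \<le> (1 - 2 * r n) * sqrt (ln (real n))"
        using elim(1) L by (simp add: L_def pos_le_divide_eq)
      also have "\<dots> \<le> ((1 - sqrt (2 * r n)) * 2) * c n"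
        using r2 s elim by (intro mult_mono) (auto simp: c_def)
      also have "\<dots> = 2 * ((1 - sqrt (2 * r n)) * c n)" by (simp only: mult_ac)
      finally show ?thesis by linarith
    qed
    note par = truncation_parameters[OF r \<epsilon> L c T, folded u_eq]
    obtain \<theta> \<beta> where \<theta>\<beta>: "0 \<le> \<theta>" "0 \<le> \<beta>"
      "pair_exponent (r n) (u n) (c n) \<theta> \<beta> \<le> - 3 * (c n)\<^sup>2 / 2 - L n"
      using par(6) by blast
    have l0: "0 \<le> l" by (simp add: l_def)
    define \<eta> where "\<eta> = exp (- (u n - 2 * sqrt (r n) * c n)\<^sup>2 / 2)"
    define \<delta> where "\<delta> = exp (- (u n)\<^sup>2 / 2 - (c n - sqrt (r n) * u n)\<^sup>2 / 2)"
    define \<kappa> where "\<kappa> = exp (pair_exponent (r n) (u n) (c n) \<theta> \<beta>)"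
    have \<eta>: "0 \<le> \<eta>" "\<eta> \<le> e n" using par(4) by (simp_all add: \<eta>_def e_def)
    have e1: "0 \<le> e n" "e n < 1" using L by (auto simp: e_def)
    have c2: "(c n)\<^sup>2 = 2 * ln (real n)" using elim by (simp add: c_def)
    have n2: "exp ((c n)\<^sup>2) = (real n)\<^sup>2" using elim by (simp add: c2 exp_double)
    have n3: "exp (3 * (c n)\<^sup>2 / 2) = (real n) ^ 3"
    proof -
      have "exp (3 * (c n)\<^sup>2 / 2) = exp (real 3 * ln (real n))" by (simp add: c2)
      also have "\<dots> = exp (ln (real n)) ^ 3" by (rule exp_of_nat_mult)
      finally show ?thesis using elim by simp
    qed
    \<comment> \<open>The factor 1/2 makes \<open>N n * (2 * n)\<close> at most
      \<open>n ^ 3\<close>, the power that the bound on \<open>\<kappa>\<close> cancels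
      exactly.\<close>
    have Nn: "0 \<le> N n" "N n \<le> (real n)\<^sup>2 / 2" by (simp add: N_def, simp add: N_eq power2_eq_square field_simps)
    have \<delta>: "N n * \<delta> \<le> e n"
    proof -
      have "N n * \<delta> \<le> (real n)\<^sup>2 * exp (- (c n)\<^sup>2 - L n)"
        using Nn par(5) by (intro mult_mono) (auto simp: \<delta>_def)
      also have "\<dots> = e n" unfolding n2[symmetric] e_def by (simp add: exp_add[symmetric])
      finally show ?thesis .
    qed
    have \<kappa>: "N n * (2 * n) * \<kappa> \<le> e n"
    proof -
      have "N n * (2 * n) \<le> (real n)\<^sup>2 / 2 * (2 * real n)" using Nn by (intro mult_mono) auto
      also have "\<dots> = (real n) ^ 3" by (simp add: power2_eq_square power3_eq_cube)
      finally have "N n * (2 * n) * \<kappa> \<le> (real n) ^ 3 * exp (- 3 * (c n)\<^sup>2 / 2 - L n)"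
        using \<theta>\<beta>(3) Nn by (intro mult_mono) (auto simp: \<kappa>_def)
      also have "\<dots> = e n" unfolding n3[symmetric] e_def by (simp add: exp_add[symmetric])
      finally show ?thesis .
    qed
    have "\<bar>?P n - exp (- l)\<bar> \<le> real n * Q (c n) +
      (\<bar>N n * Q (u n) - l\<bar> + 2 * N n * \<delta> + sqrt (N n * Q (u n) * \<eta> + N n * (2 * n) * \<kappa>) + l * \<eta>) / (1 - \<eta>)"
      unfolding \<eta>_def \<delta>_def \<kappa>_def Q_def N_def
      using prob[OF elim(3)] field[OF elim(3)] r par(1-3) \<theta>\<beta>(1,2) l0
      by (rule prob_gaussian_max_le_approx)
    also have "\<dots> \<le> ?B n"
    proof (intro add_left_mono frac_le)
      show "\<bar>N n * Q (u n) - l\<bar> + 2 * N n * \<delta> + sqrt (N n * Q (u n) * \<eta> + N n * (2 * n) * \<kappa>) + l * \<eta> \<le>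
          \<bar>N n * Q (u n) - l\<bar> + 2 * e n + sqrt (N n * Q (u n) * e n + e n) + l * e n"
        using \<delta> \<kappa> \<eta> Nn Q0[of "u n"] l0
        by (intro add_mono real_sqrt_le_mono mult_left_mono order_refl) auto
    qed (use \<eta> e1 l0 Nn Q0[of "u n"] in auto)
    finally show ?case .
  qed
  hence "(\<lambda>n. ?P n - exp (- l)) \<longlonglongrightarrow> 0"
    by (intro Lim_null_comparison[OF _ B]) simp
  hence "?P \<longlonglongrightarrow> exp (- l)" by (rule LIM_zero_cancel)
  moreover have "eventually (\<lambda>n. ?P n = cdf (distr (M n) borel (\<lambda>\<omega>. let c = sqrt (2 * ln (real n)) in
                 sqrt 2 * c * (Max ((\<lambda>p. G n p \<omega>) ` pairs n) - sqrt 2 * c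
                   + ln (4 * sqrt pi * c) / (sqrt 2 * c)))) x) sequentially"
    using eventually_ge_at_top[of 2]
  proof eventually_elim
    case (elim n)
    show ?case unfolding u_def
      using centered_gaussian_field_measurable[OF field[OF elim] _ finite_pairs]
      by (intro cdf_normalized_max[OF prob[OF elim] elim, symmetric])
  qed
  ultimately show "(\<lambda>n. cdf (distr (M n) borel (\<lambda>\<omega>. let c = sqrt (2 * ln (real n)) in
                 sqrt 2 * c * (Max ((\<lambda>p. G n p \<omega>) ` pairs n) - sqrt 2 * c
                   + ln (4 * sqrt pi * c) / (sqrt 2 * c)))) x) \<longlonglongrightarrow> cdf gumbel_measure x"
    unfolding cdf_gumbel_measure l_def[symmetric] by (rule Lim_transform_eventually)
qed

end
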